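(* Let $n$ and $k$ be integers with $n\ge 6$ and $1\le k\le n-1$. Then the maximum number of paths of length $k$ in a nonhamiltonian graph of order $n$ is $$\mathrm{P}(n-2,k-1)\left[\frac{(n-1)(n-1-k)}{2}+1\right],$$ and, up to isomorphism, this maximum number is attained uniquely by the graph $K_{n-1}\cdot K_2$.
   Context: All graphs are finite and simple. The order of a graph is its number of vertices. A graph is nonhamiltonian if it contains no Hamilton cycle (a cycle through all vertices). A path of length $k$ in a graph $G$ is a subgraph of $G$ that is a path with $k$ edges (and $k+1$ distinct vertices); paths are counted as subgraphs, so a path and its reversal are the same path. $K_n$ denotes the complete graph of order $n$. $K_{n-1}\cdot K_2$ denotes the graph of order $n$ obtained by identifying a vertex of $K_{n-1}$ with a vertex of $K_2$ (i.e. $K_{n-1}$ with one pendant edge attached at a vertex). For integers $a\ge b\ge 0$, $\mathrm{P}(a,b)=a(a-1)\cdots(a-b+1)$ if $1\le b\le a$, and $\mathrm{P}(a,0)=1$. *)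

theory Defs
  imports Complex_Main
begin

datatype 'a ugraph = Graph (verts: "'a set") (edges: "'a set set")

definition simple_graph :: "'a ugraph \<Rightarrow> bool" where
  "simple_graph G \<longleftrightarrow>
     finite (verts G) \<and> (\<forall>e \<in> edges G. e \<subseteq> verts G \<and> card e = 2)"

definition order :: "'a ugraph \<Rightarrow> nat" where
  "order G = card (verts G)"

definition subgraph :: "'a ugraph \<Rightarrow> 'a ugraph \<Rightarrow> bool" where
  "subgraph H G \<longleftrightarrow> simple_graph H \<and> verts H \<subseteq> verts G \<and> edges H \<subseteq> edges G"

definition graph_iso :: "'a ugraph \<Rightarrow> 'b ugraph \<Rightarrow> bool" where
  "graph_iso G H \<longleftrightarrow>
     (\<exists>f. bij_betw f (verts G) (verts H) \<and>
        (\<forall>u \<in> verts G. \<forall>v \<in> verts G. {u, v} \<in> edges G \<longleftrightarrow> {f u, f v} \<in> edges H))"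

definition path_graph :: "nat \<Rightarrow> 'a ugraph \<Rightarrow> bool" where
  "path_graph k H \<longleftrightarrow>
     (\<exists>vs. distinct vs \<and> length vs = k + 1 \<and>
        H = Graph (set vs) {{vs ! i, vs ! Suc i} | i. i < k})"

definition cycle_graph :: "'a ugraph \<Rightarrow> bool" where
  "cycle_graph H \<longleftrightarrow>
     (\<exists>vs. distinct vs \<and> length vs \<ge> 3 \<and>
        H = Graph (set vs) {{vs ! i, vs ! (Suc i mod length vs)} | i. i < length vs})"

definition hamiltonian :: "'a ugraph \<Rightarrow> bool" where
  "hamiltonian G \<longleftrightarrow> (\<exists>C. subgraph C G \<and> cycle_graph C \<and> verts C = verts G)"

definition nonhamiltonian_graphs :: "nat \<Rightarrow> 'a ugraph set" where
  "nonhamiltonian_graphs n = {G. simple_graph G \<and> order G = n \<and> \<not> hamiltonian G}"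

text \<open>Paths are counted as subgraphs, so a vertex sequence and its reversal give one path.\<close>

definition num_paths :: "nat \<Rightarrow> 'a ugraph \<Rightarrow> nat" where
  "num_paths k G = card {H. subgraph H G \<and> path_graph k H}"

definition complete_graph :: "'a set \<Rightarrow> 'a ugraph" where
  "complete_graph V = Graph V {e. e \<subseteq> V \<and> card e = 2}"

definition graph_union :: "'a ugraph \<Rightarrow> 'a ugraph \<Rightarrow> 'a ugraph" where
  "graph_union G H = Graph (verts G \<union> verts H) (edges G \<union> edges H)"

text \<open>For \<open>n \<ge> 2\<close> the two complete graphs below have orders \<open>n - 1\<close> and \<open>2\<close> and share exactly
  the vertex \<open>0\<close>, so their union is the identification of a vertex of one with a vertex of the
  other.\<close>

definition K_dot_K2 :: "nat \<Rightarrow> nat ugraph" where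
  "K_dot_K2 n = graph_union (complete_graph {0..<n - 1}) (complete_graph {0, n - 1})"

text \<open>\<open>a (a - 1) \<cdots> (a - b + 1)\<close>, used only for \<open>b \<le> a\<close>, where the subtraction does not truncate.\<close>

definition falling :: "nat \<Rightarrow> nat \<Rightarrow> nat" where
  "falling a b = (\<Prod>i<b. a - i)"

end

theory Submission
  imports Defs "HOL-Combinatorics.Multiset_Permutations"
begin

text \<open>
  A cyclic ordering of the vertices of a nonhamiltonian graph has at least one non-adjacent
  consecutive pair. If it has exactly one, then \<open>n - k\<close> of its \<open>n\<close> arcs of length \<open>k\<close> are paths
  of the graph; otherwise at most \<open>n - k - 1\<close> are. Averaging over all orderings reduces every
  \<open>k\<close> to the case \<open>k = n - 1\<close>, because the orderings with exactly one such pair are, up to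
  rotation, the Hamilton paths.

  To bound the number of Hamilton paths by \<open>(n - 2)!\<close>, cut these cyclic orderings at a vertex \<open>w\<close>.
  This gives linear orderings of the other vertices with exactly one defect, where starting outside
  \<open>L = N(w)\<close> or ending outside \<open>R = N(w)\<close> also counts as a defect. For arbitrary nonempty \<open>L\<close>
  and \<open>R\<close> such that no ordering of the \<open>m\<close> vertices is free of defects, there are at most
  \<open>2 (m - 1)!\<close> orderings with exactly one defect. Indeed, reversing the prefix that ends in a vertex
  of \<open>L\<close> shows that those starting outside \<open>L\<close> number at most a \<open>1 / |L|\<close> fraction of those
  starting in \<open>L\<close>. For the latter, deleting the first vertex is an induction step, which
  suffices when \<open>|L| \<le> m - 2\<close> or \<open>|R| \<le> m - 2\<close>. In the remaining case one may assume \<open>L = R\<close>;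
  then \<open>w\<close> is an ordinary vertex again and can be exchanged for one of small degree, which exists by
  Ore's argument. Cutting the original graph at a vertex of small degree leaves a strict inequality
  unless that degree is 1.
\<close>

section \<open>Orderings with exactly one defect\<close>

fun breaks :: "('a \<Rightarrow> 'a \<Rightarrow> bool) \<Rightarrow> 'a list \<Rightarrow> nat" where
  "breaks E (x # y # zs) = of_bool (\<not> E x y) + breaks E (y # zs)"
| "breaks E _ = 0"

definition cyclic_breaks :: "('a \<Rightarrow> 'a \<Rightarrow> bool) \<Rightarrow> 'a list \<Rightarrow> nat" where
  "cyclic_breaks E xs = breaks E xs + of_bool (\<not> E (last xs) (hd xs))"

text \<open>At first \<open>L\<close> and \<open>R\<close> are both the neighbourhood of the vertex
  at which a cyclic ordering is cut. They are separate parameters because deleting the first vertex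
  replaces the left set by a neighbourhood but only shrinks the right one, so equality of the two
  does not persist.\<close>

definition defects :: "('a \<Rightarrow> 'a \<Rightarrow> bool) \<Rightarrow> 'a set \<Rightarrow> 'a set \<Rightarrow> 'a list \<Rightarrow> nat" where
  "defects E L R xs = of_bool (hd xs \<notin> L) + breaks E xs + of_bool (last xs \<notin> R)"

definition one_defect :: "('a \<Rightarrow> 'a \<Rightarrow> bool) \<Rightarrow> 'a set \<Rightarrow> 'a set \<Rightarrow> 'a set \<Rightarrow> 'a list set" where
  "one_defect E U L R = {xs \<in> permutations_of_set U. defects E L R xs = 1}"

definition no_linkage :: "('a \<Rightarrow> 'a \<Rightarrow> bool) \<Rightarrow> 'a set \<Rightarrow> 'a set \<Rightarrow> 'a set \<Rightarrow> bool" where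
  "no_linkage E U L R \<longleftrightarrow> (\<forall>xs \<in> permutations_of_set U. defects E L R xs \<noteq> 0)"

text \<open>The vertex \<open>v\<close> is removed by hand because \<open>E\<close> is an arbitrary
  relation that need not be irreflexive.\<close>

definition nbhd :: "('a \<Rightarrow> 'a \<Rightarrow> bool) \<Rightarrow> 'a set \<Rightarrow> 'a \<Rightarrow> 'a set" where
  "nbhd E V v = {u \<in> V - {v}. E v u}"

section \<open>Breaks and defects under concatenation and reversal\<close>

lemma breaks_append:
  "xs \<noteq> [] \<Longrightarrow> ys \<noteq> [] \<Longrightarrow>
     breaks E (xs @ ys) = breaks E xs + of_bool (\<not> E (last xs) (hd ys)) + breaks E ys"
proof (induction xs)
  case (Cons x xs)
  then show ?case by (cases xs; cases ys) auto
qed simp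

lemma breaks_Cons: "ys \<noteq> [] \<Longrightarrow> breaks E (x # ys) = of_bool (\<not> E x (hd ys)) + breaks E ys"
  by (cases ys) auto

lemma breaks_snoc: "ys \<noteq> [] \<Longrightarrow> breaks E (ys @ [x]) = breaks E ys + of_bool (\<not> E (last ys) x)"
  by (simp add: breaks_append)

lemma breaks_rev:
  assumes "symp E"
  shows "breaks E (rev xs) = breaks E xs"
proof (induction xs)
  case (Cons x xs)
  show ?case
  proof (cases "xs = []")
    case False
    with Cons assms show ?thesis
      by (auto simp: breaks_snoc breaks_Cons last_rev dest: sympD)
  qed simp
qed simp

lemma finite_one_defect [simp]: "finite U \<Longrightarrow> finite (one_defect E U L R)"
  by (simp add: one_defect_def)

lemma defects_rev:
  assumes "symp E" "xs \<noteq> []"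
  shows "defects E L R (rev xs) = defects E R L xs"
  using assms by (simp add: defects_def breaks_rev hd_rev last_rev)

lemma rev_permutation_iff: "rev xs \<in> permutations_of_set U \<longleftrightarrow> xs \<in> permutations_of_set U"
  by (simp add: permutations_of_set_def)

lemma card_one_defect_swap:
  assumes "symp E" "U \<noteq> {}"
  shows "card (one_defect E U L R) = card (one_defect E U R L)"
proof (rule bij_betw_same_card)
  have ne: "xs \<noteq> []" if "xs \<in> permutations_of_set U" for xs
    using that assms by (auto simp: permutations_of_set_def)
  show "bij_betw rev (one_defect E U L R) (one_defect E U R L)"
  proof (rule bij_betwI[where g = rev])
    have "rev xs \<in> one_defect E U R L" if "xs \<in> one_defect E U L R" for xs L R
      using that defects_rev[OF assms(1) ne, of xs R L] rev_permutation_iff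
      by (auto simp: one_defect_def)
    then show "rev \<in> one_defect E U L R \<rightarrow> one_defect E U R L"
      "rev \<in> one_defect E U R L \<rightarrow> one_defect E U L R" by blast+
  qed simp_all
qed

lemma no_linkage_swap:
  assumes "symp E" "U \<noteq> {}"
  shows "no_linkage E U L R \<longleftrightarrow> no_linkage E U R L"
proof -
  have "no_linkage E U R L" if "no_linkage E U L R" for L R
    unfolding no_linkage_def
  proof
    fix xs assume xs: "xs \<in> permutations_of_set U"
    then have "xs \<noteq> []" "rev xs \<in> permutations_of_set U"
      using assms by (auto simp: permutations_of_set_def)
    then show "defects E R L xs \<noteq> 0"
      using that defects_rev[OF assms(1), of xs L R] by (auto simp: no_linkage_def)
  qed
  then show ?thesis by blast
qed

lemma flip_defects:
  assumes "symp E" "no_linkage E U L R" "ys @ u # zs \<in> one_defect E U L R"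
    and "ys \<noteq> []" "hd ys \<notin> L" "u \<in> L"
  shows "u # rev ys @ zs \<in> one_defect E U L R"
    and "breaks E (u # rev ys) = 0"
    and "zs \<noteq> [] \<Longrightarrow> \<not> E (hd ys) (hd zs)"
proof -
  have d: "defects E L R (ys @ u # zs) = 1" and p: "ys @ u # zs \<in> permutations_of_set U"
    using assms(3) by (auto simp: one_defect_def)
  have *: "breaks E (ys @ u # zs) = 0" "last (u # zs) \<in> R"
    using d assms(4,5) by (auto simp: defects_def split: if_splits)
  have "breaks E (ys @ [u]) = 0" and z: "breaks E zs = 0"
    using *(1) assms(4) breaks_append[of "ys @ [u]" zs E] breaks_append[of ys "u # zs" E]
    by (cases zs; simp)+
  then show b: "breaks E (u # rev ys) = 0"
    using breaks_rev[OF assms(1), of "ys @ [u]"] by simp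
  have p': "u # rev ys @ zs \<in> permutations_of_set U"
    using p by (auto simp: permutations_of_set_def)
  have b': "breaks E (u # rev ys @ zs) = (if zs = [] then 0 else of_bool (\<not> E (hd ys) (hd zs)))"
    using b z assms(4) breaks_append[of "u # rev ys" zs E] by (auto simp: last_rev)
  have "defects E L R (u # rev ys @ zs) \<noteq> 0"
    using assms(2) p' by (auto simp: no_linkage_def)
  then have "defects E L R (u # rev ys @ zs) = 1 \<and> (zs \<noteq> [] \<longrightarrow> \<not> E (hd ys) (hd zs))"
    using b' * assms(4,6) by (auto simp: defects_def last_rev split: if_splits)
  then show "u # rev ys @ zs \<in> one_defect E U L R" "zs \<noteq> [] \<Longrightarrow> \<not> E (hd ys) (hd zs)"
    using p' by (auto simp: one_defect_def)
qed

text \<open>If \<open>ys'\<close> were longer, the junction behind \<open>rev ys\<close>, which is a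
  break by \<open>flip_defects\<close>, would lie inside the segment \<open>u # rev ys'\<close>,
  which has none. Hence the image determines how long the reversed prefix was.\<close>

lemma flip_unique_aux:
  assumes "symp E" "no_linkage E U L R"
    and "ys @ u # zs \<in> one_defect E U L R" "ys' @ u # zs' \<in> one_defect E U L R"
    and "ys \<noteq> []" "hd ys \<notin> L" "ys' \<noteq> []" "hd ys' \<notin> L" "u \<in> L"
    and eq: "rev ys @ zs = rev ys' @ zs'"
  shows "length ys' \<le> length ys"
proof (rule ccontr)
  assume "\<not> ?thesis"
  then have lt: "length ys < length ys'" by simp
  have "zs \<noteq> []"
    using arg_cong[OF eq, of length] lt by auto
  obtain ws where ws: "rev ys' = rev ys @ ws" "zs = ws @ zs'"
  proof -
    obtain us where us: "rev ys = rev ys' @ us \<and> us @ zs = zs' \<or> rev ys @ us = rev ys' \<and> zs = us @ zs'"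
      using eq by (auto simp: append_eq_append_conv2)
    moreover have "rev ys \<noteq> rev ys' @ us"
    proof
      assume "rev ys = rev ys' @ us"
      from arg_cong[OF this, of length] lt show False by simp
    qed
    ultimately have "rev ys' = rev ys @ us" "zs = us @ zs'" by auto
    then show ?thesis by (rule that)
  qed
  have "ws \<noteq> []" using arg_cong[OF ws(1), of length] lt by auto
  have "breaks E ((u # rev ys) @ ws) = 0"
    using flip_defects(2)[OF assms(1,2,4,7,8,9)] ws by simp
  then have "E (last (u # rev ys)) (hd ws)"
    using \<open>ws \<noteq> []\<close> breaks_append[of "u # rev ys" ws E] by simp
  then have "E (hd ys) (hd zs)"
    using ws \<open>ws \<noteq> []\<close> assms(5) by (simp add: last_rev)
  then show False
    using flip_defects(3)[OF assms(1,2,3,5,6,9)] \<open>zs \<noteq> []\<close> by blast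
qed

text \<open>Each ordering that starts outside \<open>L\<close> contains every \<open>u\<close> in
  \<open>L\<close> and can be flipped at each of them. The images start in \<open>L\<close>, and all
  pairs of a vertex and an ordering have different images.\<close>

lemma start_defect_bound:
  assumes "symp E" "finite U" "L \<subseteq> U" "no_linkage E U L R"
  shows "card L * card {xs \<in> one_defect E U L R. hd xs \<notin> L}
           \<le> card {xs \<in> one_defect E U L R. hd xs \<in> L}"
proof -
  let ?S = "{xs \<in> one_defect E U L R. hd xs \<notin> L}"
  let ?T = "{xs \<in> one_defect E U L R. hd xs \<in> L}"
  define flip :: "'a \<times> 'a list \<Rightarrow> 'a list" where
    "flip = (\<lambda>(u, xs).
      u # rev (takeWhile (\<lambda>x. x \<noteq> u) xs) @ tl (dropWhile (\<lambda>x. x \<noteq> u) xs))"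
  have split: "\<exists>ys zs. xs = ys @ u # zs \<and> ys \<noteq> [] \<and> hd ys \<notin> L \<and> flip (u, xs) = u # rev ys @ zs"
    if "u \<in> L" "xs \<in> ?S" for u xs
  proof -
    have "u \<in> set xs" using that assms(3) by (auto simp: one_defect_def permutations_of_set_def)
    then obtain ys zs where *: "xs = ys @ u # zs" "u \<notin> set ys"
      by (auto dest: split_list_first)
    then have "ys \<noteq> []" using that by auto
    moreover have "flip (u, xs) = u # rev ys @ zs"
    proof -
      have "\<And>x. x \<in> set ys \<Longrightarrow> x \<noteq> u" using *(2) by auto
      then show ?thesis using *(1) by (simp add: flip_def takeWhile_append2 dropWhile_append2)
    qed
    ultimately show ?thesis using * that by auto
  qed
  have "inj_on flip (L \<times> ?S)"
  proof (rule inj_onI, clarify)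
    fix u xs u' xs'
    assume *: "u \<in> L" "xs \<in> one_defect E U L R" "hd xs \<notin> L"
      "u' \<in> L" "xs' \<in> one_defect E U L R" "hd xs' \<notin> L" "flip (u, xs) = flip (u', xs')"
    obtain ys zs where 1: "xs = ys @ u # zs" "ys \<noteq> []" "hd ys \<notin> L" "flip (u, xs) = u # rev ys @ zs"
      using split * by blast
    obtain ys' zs' where 2: "xs' = ys' @ u' # zs'" "ys' \<noteq> []" "hd ys' \<notin> L" "flip (u', xs') = u' # rev ys' @ zs'"
      using split * by blast
    have u: "u' = u" and eq: "rev ys @ zs = rev ys' @ zs'" using * 1 2 by auto
    have "length ys' \<le> length ys" "length ys \<le> length ys'"
      using flip_unique_aux[OF assms(1,4), of ys u zs ys' zs']
        flip_unique_aux[OF assms(1,4), of ys' u zs' ys zs] * 1 2 u eq by simp_all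
    then have "ys = ys'" "zs = zs'" using eq by auto
    with 1 2 u show "u = u' \<and> xs = xs'" by simp
  qed
  moreover have "flip ` (L \<times> ?S) \<subseteq> ?T"
  proof clarify
    fix u xs assume *: "u \<in> L" "xs \<in> one_defect E U L R" "hd xs \<notin> L"
    obtain ys zs where 1: "xs = ys @ u # zs" "ys \<noteq> []" "hd ys \<notin> L" "flip (u, xs) = u # rev ys @ zs"
      using split * by blast
    then show "flip (u, xs) \<in> one_defect E U L R \<and> hd (flip (u, xs)) \<in> L"
      using flip_defects(1)[OF assms(1,4)] * by auto
  qed
  ultimately have "card (L \<times> ?S) \<le> card ?T"
    using assms(2) by (intro card_inj_on_le) auto
  then show ?thesis by (simp add: card_cartesian_product)
qed

section \<open>Deleting the first vertex\<close>

lemma Cons_permutation_iff: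
  assumes "u \<in> U"
  shows "u # ys \<in> permutations_of_set U \<longleftrightarrow> ys \<in> permutations_of_set (U - {u})"
proof -
  have "insert u (set ys) = U \<and> u \<notin> set ys \<longleftrightarrow> set ys = U - {u}" using assms by blast
  then show ?thesis by (auto simp: permutations_of_set_def)
qed

lemma Diff_singleton_nonempty:
  assumes "u \<in> U" "card U \<ge> 2"
  shows "U - {u} \<noteq> {}"
proof -
  have "card (U - {u}) \<noteq> 0" using assms by simp
  then show ?thesis by (metis card.empty)
qed

text \<open>The edge leaving \<open>u\<close> becomes the start condition of the tail, which is why
  \<open>nbhd E U u\<close> takes the place of \<open>L\<close>. The bound on \<open>card U\<close>
  makes the tail nonempty, so that \<open>hd\<close> and \<open>last\<close> of it are
  meaningful.\<close>

lemma defects_Cons: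
  assumes "u \<in> L" "u \<in> U" "card U \<ge> 2" "ys \<in> permutations_of_set (U - {u})"
  shows "defects E L R (u # ys) = defects E (nbhd E U u) (R - {u}) ys"
proof -
  have set: "set ys = U - {u}" using assms(4) by (simp add: permutations_of_set_def)
  have ne: "ys \<noteq> []"
  proof
    assume "ys = []"
    then have "U - {u} = {}" using set by (metis list.set(1))
    then show False using Diff_singleton_nonempty[OF assms(2,3)] by contradiction
  qed
  have "hd ys \<in> U - {u}" "last ys \<in> U - {u}"
    using hd_in_set[OF ne] last_in_set[OF ne] by (simp_all only: set)
  then have "hd ys \<in> nbhd E U u \<longleftrightarrow> E u (hd ys)" "last ys \<in> R - {u} \<longleftrightarrow> last ys \<in> R"
    by (simp_all add: nbhd_def)
  then show ?thesis using assms(1) ne by (simp add: defects_def breaks_Cons)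
qed

lemma no_linkage_tail:
  assumes "no_linkage E U L R" "u \<in> L" "u \<in> U" "card U \<ge> 2"
  shows "no_linkage E (U - {u}) (nbhd E U u) (R - {u})"
  unfolding no_linkage_def
proof
  fix ys assume ys: "ys \<in> permutations_of_set (U - {u})"
  then have "u # ys \<in> permutations_of_set U"
    by (simp add: Cons_permutation_iff[OF assms(3)])
  then show "defects E (nbhd E U u) (R - {u}) ys \<noteq> 0"
    using assms(1) by (simp add: no_linkage_def defects_Cons[OF assms(2-4) ys, symmetric])
qed

lemma card_one_defect_hd:
  assumes "u \<in> L" "u \<in> U" "card U \<ge> 2"
  shows "card {xs \<in> one_defect E U L R. hd xs = u}
           = card (one_defect E (U - {u}) (nbhd E U u) (R - {u}))"
proof -
  have "[] \<notin> permutations_of_set U" using assms(2) by (auto simp: permutations_of_set_def)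
  then have "{xs \<in> one_defect E U L R. hd xs = u} = (#) u ` {ys. u # ys \<in> one_defect E U L R}"
    by (auto simp: image_iff one_defect_def) (metis list.exhaust_sel)
  also have "{ys. u # ys \<in> one_defect E U L R} = one_defect E (U - {u}) (nbhd E U u) (R - {u})"
    using defects_Cons[OF assms] by (auto simp: one_defect_def Cons_permutation_iff[OF assms(2)])
  finally show ?thesis by (simp add: card_image)
qed

text \<open>Let \<open>s\<close> and \<open>t\<close> count the orderings starting outside and
  inside \<open>L\<close>. From \<open>card L * s \<le> t\<close> follows
  \<open>card L * (s + t) \<le> (card L + 1) * t\<close>.\<close>

lemma card_one_defect_split:
  assumes "symp E" "finite U" "L \<subseteq> U" "no_linkage E U L R"
  shows "card L * card (one_defect E U L R)
           \<le> (card L + 1) * (\<Sum>u\<in>L. card {xs \<in> one_defect E U L R. hd xs = u})"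
proof -
  let ?S = "{xs \<in> one_defect E U L R. hd xs \<notin> L}"
  let ?T = "{xs \<in> one_defect E U L R. hd xs \<in> L}"
  have fin: "finite (one_defect E U L R)" using assms by simp
  have "card (one_defect E U L R) = card ?S + card ?T"
    using fin by (subst card_Un_disjoint[symmetric]) (auto intro: arg_cong[of _ _ card])
  moreover have "card ?T = (\<Sum>u\<in>L. card {xs \<in> one_defect E U L R. hd xs = u})"
  proof -
    have "?T = (\<Union>u\<in>L. {xs \<in> one_defect E U L R. hd xs = u})" by auto
    then show ?thesis
      using fin finite_subset[OF assms(3,2)] by (simp, intro card_UN_disjoint) auto
  qed
  ultimately show ?thesis
    using start_defect_bound[OF assms] by (simp add: algebra_simps)
qed

lemma card_one_defect_le_of_tail:
  assumes "symp E" "finite U" "L \<subseteq> U" "L \<noteq> {}" "no_linkage E U L R"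
    and "\<And>u. u \<in> L \<Longrightarrow> card {xs \<in> one_defect E U L R. hd xs = u} \<le> B"
  shows "card (one_defect E U L R) \<le> (card L + 1) * B"
proof -
  have "card L > 0"
    using assms(2-4) by (meson card_gt_0_iff finite_subset)
  have "card L * card (one_defect E U L R) \<le> (card L + 1) * (card L * B)"
  proof -
    have "(\<Sum>u\<in>L. card {xs \<in> one_defect E U L R. hd xs = u}) \<le> card L * B"
      using sum_bounded_above[of L "\<lambda>u. card {xs \<in> one_defect E U L R. hd xs = u}" B] assms(6) by simp
    then show ?thesis
      using card_one_defect_split[OF assms(1-3,5)] mult_le_mono2 le_trans by blast
  qed
  also have "\<dots> = card L * ((card L + 1) * B)" by (simp add: algebra_simps)
  finally show ?thesis using \<open>card L > 0\<close> by simp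
qed

section \<open>Degenerate cases of the bound\<close>

lemma card_permutations_hd:
  assumes "finite U" "u \<in> U"
  shows "card {xs \<in> permutations_of_set U. hd xs = u} = fact (card U - 1)"
proof -
  have "[] \<notin> permutations_of_set U" using assms(2) by (auto simp: permutations_of_set_def)
  then have "{xs \<in> permutations_of_set U. hd xs = u} = (#) u ` {ys. u # ys \<in> permutations_of_set U}"
    by (auto simp: image_iff) (metis list.exhaust_sel)
  also have "\<dots> = (#) u ` permutations_of_set (U - {u})"
    by (simp add: Cons_permutation_iff[OF assms(2)])
  finally show ?thesis using assms by (simp add: card_image)
qed

lemma card_permutations_last:
  assumes "finite U" "u \<in> U"
  shows "card {xs \<in> permutations_of_set U. last xs = u} = fact (card U - 1)"
proof -
  have "bij_betw rev {xs \<in> permutations_of_set U. last xs = u} {xs \<in> permutations_of_set U. hd xs = u}"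
    by (rule bij_betwI[where g = rev]) (auto simp: permutations_of_set_def hd_rev last_rev)
  then show ?thesis using card_permutations_hd[OF assms] by (simp add: bij_betw_same_card)
qed

lemma card_one_defect_hd_le:
  assumes "finite U" "u \<in> U"
  shows "card {xs \<in> one_defect E U L R. hd xs = u} \<le> fact (card U - 1)"
proof -
  have "card {xs \<in> one_defect E U L R. hd xs = u} \<le> card {xs \<in> permutations_of_set U. hd xs = u}"
    using assms(1) by (intro card_mono) (auto simp: one_defect_def)
  then show ?thesis by (simp only: card_permutations_hd[OF assms])
qed

text \<open>The factor \<open>card L + 1\<close> is 2 here, so the trivial count of all orderings
  starting at the one vertex of \<open>L\<close> already gives the bound.\<close>

lemma card_one_defect_singleton:
  assumes "symp E" "finite U" "no_linkage E U L R" "L \<subseteq> U" "card L = 1"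
  shows "card (one_defect E U L R) \<le> 2 * fact (card U - 1)"
proof -
  have "L \<noteq> {}" using assms(5) by auto
  then have "card (one_defect E U L R) \<le> (card L + 1) * fact (card U - 1)"
    using card_one_defect_hd_le[OF assms(2)] assms(4)
    by (intro card_one_defect_le_of_tail assms) auto
  then show ?thesis using assms(5) by simp
qed

text \<open>In the interior of an ordering \<open>u\<close> would cause a break on both sides, so it
  must be the first or the last vertex.\<close>

lemma card_one_defect_isolated:
  assumes "symp E" "finite U" "u \<in> U" "nbhd E U u = {}"
  shows "card (one_defect E U L R) \<le> 2 * fact (card U - 1)"
proof -
  have "hd xs = u \<or> last xs = u" if xs: "xs \<in> one_defect E U L R" for xs
  proof (rule ccontr)
    assume *: "\<not> ?thesis"
    have p: "distinct xs" "set xs = U" using xs by (auto simp: one_defect_def permutations_of_set_def)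
    then obtain ys zs where yz: "xs = ys @ u # zs" using assms(3) split_list by metis
    then have ne: "ys \<noteq> []" "zs \<noteq> []" using * by auto
    have "last ys \<in> U - {u}" "hd zs \<in> U - {u}" using p yz ne by auto
    then have "\<not> E u (last ys)" "\<not> E u (hd zs)" using assms(4) by (auto simp: nbhd_def)
    then have "breaks E xs \<ge> 2"
      using yz ne assms(1) by (auto simp: breaks_append breaks_Cons dest: sympD)
    then show False using xs by (simp add: one_defect_def defects_def)
  qed
  then have "one_defect E U L R \<subseteq> {xs \<in> permutations_of_set U. hd xs = u} \<union> {xs \<in> permutations_of_set U. last xs = u}"
    by (auto simp: one_defect_def)
  then have "card (one_defect E U L R) \<le> card ({xs \<in> permutations_of_set U. hd xs = u} \<union> {xs \<in> permutations_of_set U. last xs = u})"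
    using assms(2) by (intro card_mono) auto
  also have "\<dots> \<le> fact (card U - 1) + fact (card U - 1)"
    using card_Un_le[of "{xs \<in> permutations_of_set U. hd xs = u}" "{xs \<in> permutations_of_set U. last xs = u}"]
      card_permutations_hd[OF assms(2,3)] card_permutations_last[OF assms(2,3)] by simp
  finally show ?thesis by simp
qed

section \<open>Cyclic orderings and Hamilton paths\<close>

definition nonham :: "('a \<Rightarrow> 'a \<Rightarrow> bool) \<Rightarrow> 'a set \<Rightarrow> bool" where
  "nonham E V \<longleftrightarrow> (\<forall>xs \<in> permutations_of_set V. cyclic_breaks E xs \<noteq> 0)"

text \<open>Lists carry a direction: with at least two vertices, each Hamilton path gives two lists.
  This accounts for the factor 2 in the bounds \<open>2 * fact (card V - 2)\<close>.\<close>

definition ham_lists :: "('a \<Rightarrow> 'a \<Rightarrow> bool) \<Rightarrow> 'a set \<Rightarrow> 'a list set" where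
  "ham_lists E V = {xs \<in> permutations_of_set V. breaks E xs = 0}"

lemma finite_ham_lists [simp]: "finite V \<Longrightarrow> finite (ham_lists E V)"
  by (simp add: ham_lists_def)

lemma breaks_conv_sum:
  "breaks E xs = (\<Sum>i<length xs - 1. of_bool (\<not> E (xs ! i) (xs ! Suc i)))"
proof (induction xs)
  case (Cons x xs)
  then show ?case
    by (cases xs) (simp_all add: sum.lessThan_Suc_shift del: sum.lessThan_Suc)
qed simp

lemma breaks_eq_0_iff:
  "breaks E xs = 0 \<longleftrightarrow> (\<forall>i<length xs - 1. E (xs ! i) (xs ! Suc i))"
  by (auto simp: breaks_conv_sum)

definition bad_positions :: "('a \<Rightarrow> 'a \<Rightarrow> bool) \<Rightarrow> 'a list \<Rightarrow> nat set" where
  "bad_positions E xs = {i. i < length xs \<and> \<not> E (xs ! i) (xs ! (Suc i mod length xs))}"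

lemma cyclic_breaks_conv_card:
  assumes "xs \<noteq> []"
  shows "cyclic_breaks E xs = card (bad_positions E xs)"
proof -
  obtain m where m: "length xs = Suc m" using assms by (cases xs) auto
  have "(\<Sum>i<Suc m. of_bool (\<not> E (xs ! i) (xs ! (Suc i mod Suc m)))) =
      (\<Sum>i<m. of_bool (\<not> E (xs ! i) (xs ! Suc i))) + (of_bool (\<not> E (xs ! m) (xs ! 0)) :: nat)"
    by (simp add: sum.lessThan_Suc)
  also have "\<dots> = cyclic_breaks E xs"
    using assms m by (simp add: cyclic_breaks_def breaks_conv_sum last_conv_nth hd_conv_nth)
  finally have "cyclic_breaks E xs = (\<Sum>i<Suc m. of_bool (\<not> E (xs ! i) (xs ! (Suc i mod Suc m))))"
    by simp
  also have "\<dots> = card ({..<Suc m} \<inter> {i. \<not> E (xs ! i) (xs ! (Suc i mod Suc m))})"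
    by (simp only: of_bool_def sum.If_cases finite_lessThan sum.neutral_const sum_constant) simp
  also have "{..<Suc m} \<inter> {i. \<not> E (xs ! i) (xs ! (Suc i mod Suc m))} = bad_positions E xs"
    using m by (auto simp: bad_positions_def)
  finally show ?thesis .
qed

lemma cyclic_breaks_rotate1: "cyclic_breaks E (rotate1 xs) = cyclic_breaks E xs"
proof (cases xs)
  case (Cons x ys)
  then show ?thesis
    by (cases "ys = []") (simp_all add: cyclic_breaks_def breaks_snoc breaks_Cons)
qed simp

lemma cyclic_breaks_rotate: "cyclic_breaks E (rotate i xs) = cyclic_breaks E xs"
  by (induction i) (simp_all add: cyclic_breaks_rotate1)

lemma rotate_permutation: "rotate i xs \<in> permutations_of_set V \<longleftrightarrow> xs \<in> permutations_of_set V"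
  by (simp add: permutations_of_set_def)

lemma length_permutation: "xs \<in> permutations_of_set V \<Longrightarrow> length xs = card V"
  by (auto simp: permutations_of_set_def distinct_card)

text \<open>Every rotation permutes \<open>S\<close>, so after exchanging the two sums each of the
  \<open>n\<close> rotations contributes the same number.\<close>

lemma sum_card_rotations:
  assumes "finite S" "\<And>xs. xs \<in> S \<Longrightarrow> length xs = n" "\<And>xs i. xs \<in> S \<Longrightarrow> rotate i xs \<in> S"
  shows "(\<Sum>xs\<in>S. card {i. i < n \<and> Q (rotate i xs)}) = n * card {xs \<in> S. Q xs}"
proof -
  have bij: "bij_betw (rotate i) S S" if "i < n" for i
  proof (rule bij_betwI[where g = "rotate (n - i)"])
    show "rotate i \<in> S \<rightarrow> S" "rotate (n - i) \<in> S \<rightarrow> S" using assms(3) by auto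
    show "rotate (n - i) (rotate i xs) = xs" "rotate i (rotate (n - i) xs) = xs" if "xs \<in> S" for xs
      using assms(2)[OF that] \<open>i < n\<close> by (simp_all add: rotate_rotate)
  qed
  have c: "card {i. i < n \<and> Q (rotate i xs)} = (\<Sum>i<n. of_bool (Q (rotate i xs)))" for xs
  proof -
    have "{i. i < n \<and> Q (rotate i xs)} = {..<n} \<inter> {i. Q (rotate i xs)}" by auto
    then show ?thesis by (simp add: of_bool_def sum.If_cases)
  qed
  have "(\<Sum>xs\<in>S. card {i. i < n \<and> Q (rotate i xs)}) = (\<Sum>i<n. \<Sum>xs\<in>S. of_bool (Q (rotate i xs)))"
    unfolding c by (rule sum.swap)
  also have "\<dots> = (\<Sum>i<n. \<Sum>xs\<in>S. of_bool (Q xs))"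
  proof (rule sum.cong[OF refl])
    fix i assume "i \<in> {..<n}"
    then have "bij_betw (rotate i) S S" using bij by simp
    from sum.reindex_bij_betw[OF this, of "\<lambda>xs. of_bool (Q xs)"]
    show "(\<Sum>xs\<in>S. of_bool (Q (rotate i xs))) = (\<Sum>xs\<in>S. of_bool (Q xs))" .
  qed
  also have "(\<Sum>xs\<in>S. of_bool (Q xs)) = card {xs \<in> S. Q xs}"
  proof -
    have "{xs \<in> S. Q xs} = S \<inter> {xs. Q xs}" by auto
    then show ?thesis using assms(1) by (simp add: of_bool_def sum.If_cases)
  qed
  finally show ?thesis by simp
qed

lemma cyclic_breaks_Cons:
  assumes "symp E" "w \<in> V" "ys \<in> permutations_of_set (V - {w})" "ys \<noteq> []"
  shows "cyclic_breaks E (w # ys) = defects E (nbhd E V w) (nbhd E V w) ys"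
proof -
  have "hd ys \<in> V - {w}" "last ys \<in> V - {w}"
    using hd_in_set[OF assms(4)] last_in_set[OF assms(4)] assms(3) by (simp_all add: permutations_of_set_def)
  then have "hd ys \<in> nbhd E V w \<longleftrightarrow> E w (hd ys)" "last ys \<in> nbhd E V w \<longleftrightarrow> E (last ys) w"
    using assms(1) by (auto simp: nbhd_def dest: sympD)
  then show ?thesis using assms(4) by (simp add: cyclic_breaks_def defects_def breaks_Cons)
qed

text \<open>Rotation brings \<open>w\<close> to the front without changing
  \<open>cyclic_breaks\<close>; deleting \<open>w\<close> then turns its two cyclic edges into the
  two end conditions.\<close>

lemma nonham_iff_no_linkage:
  assumes "symp E" "w \<in> V" "card V \<ge> 2"
  shows "nonham E V \<longleftrightarrow> no_linkage E (V - {w}) (nbhd E V w) (nbhd E V w)"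
proof -
  have ne: "ys \<noteq> []" if "ys \<in> permutations_of_set (V - {w})" for ys
    using that Diff_singleton_nonempty[OF assms(2,3)] by (metis list.set(1) permutations_of_setD(1))
  have "nonham E V \<longleftrightarrow> (\<forall>ys. w # ys \<in> permutations_of_set V \<longrightarrow> cyclic_breaks E (w # ys) \<noteq> 0)"
  proof
    assume *: "\<forall>ys. w # ys \<in> permutations_of_set V \<longrightarrow> cyclic_breaks E (w # ys) \<noteq> 0"
    show "nonham E V" unfolding nonham_def
    proof
      fix xs assume xs: "xs \<in> permutations_of_set V"
      then have "w \<in> set xs" using assms(2) by (simp add: permutations_of_set_def)
      then obtain as bs where "xs = as @ w # bs" by (meson split_list)
      then have r: "rotate (length as) xs = w # bs @ as" by (simp add: rotate_append)
      show "cyclic_breaks E xs \<noteq> 0"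
        using * xs rotate_permutation[of "length as" xs V] cyclic_breaks_rotate[of E "length as" xs]
        unfolding r by metis
    qed
  qed (simp add: nonham_def)
  also have "\<dots> \<longleftrightarrow> no_linkage E (V - {w}) (nbhd E V w) (nbhd E V w)"
    unfolding no_linkage_def Cons_permutation_iff[OF assms(2)]
    using cyclic_breaks_Cons[OF assms(1,2) _ ne] by auto
  finally show ?thesis .
qed

section \<open>Arcs of a cyclic ordering\<close>

lemma card_windows:
  assumes "p < n" "k \<le> n"
  shows "card {i. i < n \<and> (\<exists>j<k. (i + j) mod n = p)} = k"
proof -
  \<comment> \<open>The start is \<open>p - j\<close> modulo \<open>n\<close>; adding
    \<open>n - j\<close> instead of subtracting \<open>j\<close> avoids truncation.\<close>
  have "{i. i < n \<and> (\<exists>j<k. (i + j) mod n = p)} = (\<lambda>j. (p + (n - j)) mod n) ` {..<k}"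
  proof (intro equalityI subsetI)
    fix i assume "i \<in> {i. i < n \<and> (\<exists>j<k. (i + j) mod n = p)}"
    then obtain j where j: "i < n" "j < k" "(i + j) mod n = p" by blast
    have "(p + (n - j)) mod n = (i + j + (n - j)) mod n"
      unfolding j(3)[symmetric] by (simp add: mod_add_left_eq)
    also have "\<dots> = i" using j assms by simp
    finally show "i \<in> (\<lambda>j. (p + (n - j)) mod n) ` {..<k}" using j by (metis imageI lessThan_iff)
  next
    fix i assume "i \<in> (\<lambda>j. (p + (n - j)) mod n) ` {..<k}"
    then obtain j where j: "j < k" "i = (p + (n - j)) mod n" by auto
    have "(i + j) mod n = (p + (n - j) + j) mod n"
      unfolding j(2) by (simp add: mod_add_left_eq)
    also have "\<dots> = p" using j assms by simp
    finally show "i \<in> {i. i < n \<and> (\<exists>j<k. (i + j) mod n = p)}" using j assms by auto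
  qed
  moreover have "inj_on (\<lambda>j. (p + (n - j)) mod n) {..<k}"
  proof (rule inj_onI)
    fix j j' assume *: "j \<in> {..<k}" "j' \<in> {..<k}" "(p + (n - j)) mod n = (p + (n - j')) mod n"
    have **: "j = j'" if "j \<le> j'" "j' < n" "(p + (n - j)) mod n = (p + (n - j')) mod n" for j j'
    proof -
      have "(p + (n - j) + j) mod n = (p + (n - j') + j) mod n"
        using that(3) by (metis mod_add_left_eq)
      moreover have "p + (n - j) + j = p + n" "p + (n - j') + j = p + (n - (j' - j))"
        using that by simp_all
      ultimately have "p = (p + (n - (j' - j))) mod n" using assms(1) by (metis mod_add_self2 mod_less)
      \<comment> \<open>The shift \<open>n - (j' - j)\<close> lies strictly between 0 and
        \<open>n\<close>, so it moves \<open>p\<close> modulo \<open>n\<close>.\<close>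
      moreover have "p + (n - (j' - j)) \<noteq> p \<and> (p + (n - (j' - j))) mod n \<noteq> p" if "j < j'"
        using that \<open>j' < n\<close> assms by (auto simp: mod_if)
      ultimately show "j = j'" using that(1) by fastforce
    qed
    show "j = j'"
      using ** [of j j'] ** [of j' j] * assms(2) by (cases "j \<le> j'") auto
  qed
  ultimately show ?thesis by (simp add: card_image)
qed

text \<open>The starts of the arcs covering \<open>p\<close> form a cyclic interval that ends in
  \<open>p\<close>: it contains \<open>p\<close> but, because \<open>k < n\<close>, not the next
  position. This recovers \<open>p\<close> from the set.\<close>

lemma windows_inj:
  fixes n k p q :: nat
  assumes "p < n" "q < n" "1 \<le> k" "k < n"
    and "{i. i < n \<and> (\<exists>j<k. (i + j) mod n = p)} = {i. i < n \<and> (\<exists>j<k. (i + j) mod n = q)}"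
  shows "p = q"
proof -
  have "p \<in> {i. i < n \<and> (\<exists>j<k. (i + j) mod n = p)}"
  proof -
    have "0 < k \<and> (p + 0) mod n = p" using assms(1,3) by simp
    then show ?thesis using assms(1) by blast
  qed
  then have "p \<in> {i. i < n \<and> (\<exists>j<k. (i + j) mod n = q)}" by (simp only: assms(5))
  then obtain j where j: "j < k" "(p + j) mod n = q" by auto
  have "Suc p mod n \<notin> {i. i < n \<and> (\<exists>j<k. (i + j) mod n = p)}"
  proof
    assume "Suc p mod n \<in> {i. i < n \<and> (\<exists>j<k. (i + j) mod n = p)}"
    then obtain i where i: "i < k" "(Suc p + i) mod n = p" by (auto simp: mod_simps)
    then show False
      using assms(1,4) by (cases "Suc p + i < n") (simp_all add: le_mod_geq)
  qed
  then have "Suc p mod n \<notin> {i. i < n \<and> (\<exists>j<k. (i + j) mod n = q)}" unfolding assms(5) .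
  then have "\<And>i. i < k \<Longrightarrow> (Suc p + i) mod n \<noteq> q" using assms(1) by (auto simp: mod_simps)
  \<comment> \<open>For positive \<open>j\<close>, the number \<open>j - 1\<close> would be a
    witness for the successor of \<open>p\<close>.\<close>
  then have "j = 0" using j by (cases j) auto
  then show ?thesis using j assms(1) by simp
qed

definition good_rotations :: "('a \<Rightarrow> 'a \<Rightarrow> bool) \<Rightarrow> nat \<Rightarrow> 'a list \<Rightarrow> nat set" where
  "good_rotations E k xs = {i. i < length xs \<and> breaks E (take (Suc k) (rotate i xs)) = 0}"

text \<open>The \<open>k + 1\<close> vertices kept by \<open>take (Suc k)\<close> span the edge
  positions \<open>i, ..., i + k - 1\<close> modulo the length, so a rotation is good exactly when
  none of these is bad.\<close>

lemma good_rotations_eq: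
  assumes "k < length xs"
  shows "good_rotations E k xs =
    {..<length xs} - (\<Union>p\<in>bad_positions E xs. {i. i < length xs \<and> (\<exists>j<k. (i + j) mod length xs = p)})"
proof -
  let ?n = "length xs"
  have "breaks E (take (Suc k) (rotate i xs)) = 0 \<longleftrightarrow> (\<forall>j<k. (i + j) mod ?n \<notin> bad_positions E xs)"
    if "i < ?n" for i
  proof -
    have "(\<forall>j<k. (i + j) mod ?n \<notin> bad_positions E xs) \<longleftrightarrow>
        (\<forall>j<k. E (xs ! ((i + j) mod ?n)) (xs ! ((i + Suc j) mod ?n)))"
    proof -
      have "?n > 0" using assms by linarith
      then show ?thesis by (simp add: bad_positions_def mod_Suc_eq)
    qed
    also have "\<dots> \<longleftrightarrow> breaks E (take (Suc k) (rotate i xs)) = 0"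
      using assms by (auto simp: breaks_eq_0_iff nth_rotate)
    finally show ?thesis by blast
  qed
  then show ?thesis unfolding good_rotations_def by blast
qed

lemma card_good_rotations_one:
  assumes "card (bad_positions E xs) = 1" "k < length xs"
  shows "card (good_rotations E k xs) = length xs - k"
proof -
  obtain p where p: "bad_positions E xs = {p}" using assms(1) by (auto simp: card_1_singleton_iff)
  then have "p < length xs" by (auto simp: bad_positions_def)
  have "good_rotations E k xs = {..<length xs} - {i. i < length xs \<and> (\<exists>j<k. (i + j) mod length xs = p)}"
    using good_rotations_eq[OF assms(2)] p by simp
  moreover have "card \<dots> = length xs - k"
    using card_windows[OF \<open>p < length xs\<close>, of k] assms(2) by (subst card_Diff_subset) auto
  ultimately show ?thesis by simp
qed

text \<open>Each bad position rules out exactly \<open>k\<close> rotations, and different positions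
  rule out different sets, so two of them rule out at least \<open>k + 1\<close>.\<close>

lemma card_good_rotations_many:
  assumes "card (bad_positions E xs) \<ge> 2" "1 \<le> k" "k < length xs"
  shows "card (good_rotations E k xs) \<le> length xs - k - 1"
proof -
  let ?W = "\<lambda>p. {i. i < length xs \<and> (\<exists>j<k. (i + j) mod length xs = p)}"
  obtain p q where pq: "p \<in> bad_positions E xs" "q \<in> bad_positions E xs" "p \<noteq> q"
    using assms(1) by (metis card_le_Suc0_iff_eq card.infinite not_less_eq_eq numeral_2_eq_2 zero_le)
  then have lt: "p < length xs" "q < length xs" by (auto simp: bad_positions_def)
  have "good_rotations E k xs \<subseteq> {..<length xs} - (?W p \<union> ?W q)"
    unfolding good_rotations_eq[OF assms(3)] using pq by blast
  then have "card (good_rotations E k xs) \<le> card ({..<length xs} - (?W p \<union> ?W q))"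
    by (intro card_mono) auto
  also have "\<dots> = length xs - card (?W p \<union> ?W q)"
    by (subst card_Diff_subset) auto
  finally have *: "card (good_rotations E k xs) \<le> length xs - card (?W p \<union> ?W q)" .
  have c: "card (?W p) = k" "card (?W q) = k" using card_windows lt assms(3) by auto
  have "?W p \<noteq> ?W q" using windows_inj[OF lt assms(2,3)] pq(3) by blast
  then have "\<not> ?W q \<subseteq> ?W p" using card_subset_eq[of "?W p" "?W q"] c by auto
  then have "?W p \<subset> ?W p \<union> ?W q" by blast
  then have "k < card (?W p \<union> ?W q)" using psubset_card_mono[of "?W p \<union> ?W q" "?W p"] c by auto
  then show ?thesis using * by linarith
qed

text \<open>An ordering with one cyclic break has exactly one break-free rotation, the one cut at
  that break. Conversely, a break-free ordering must fail at its closing edge because of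
  \<open>nonham\<close>. Counting pairs of orderings and rotations gives the factor
  \<open>card V\<close>.\<close>

lemma card_single_cyclic_break:
  assumes "finite V" "card V \<ge> 2" "nonham E V"
  shows "card {xs \<in> permutations_of_set V. cyclic_breaks E xs = 1} = card V * card (ham_lists E V)"
proof -
  let ?n = "card V"
  define S where "S = {xs \<in> permutations_of_set V. cyclic_breaks E xs = 1}"
  have fin: "finite S" using assms(1) by (simp add: S_def)
  have len: "length xs = ?n" if "xs \<in> S" for xs using that by (simp add: S_def length_permutation)
  have rot: "rotate i xs \<in> S" if "xs \<in> S" for xs i
    using that by (simp add: S_def rotate_permutation cyclic_breaks_rotate)
  have "card {i. i < ?n \<and> breaks E (rotate i xs) = 0} = 1" if xs: "xs \<in> S" for xs
  proof -
    have l: "length xs = ?n" using len[OF xs] .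
    then have ne: "xs \<noteq> []" using assms(2) by auto
    then have "card (bad_positions E xs) = 1"
      using xs cyclic_breaks_conv_card[of xs E] by (simp add: S_def)
    then have "card (good_rotations E (?n - 1) xs) = 1"
      using card_good_rotations_one[of E xs "?n - 1"] l assms(2) by simp
    moreover have "good_rotations E (?n - 1) xs = {i. i < ?n \<and> breaks E (rotate i xs) = 0}"
      using l assms(2) by (simp add: good_rotations_def)
    ultimately show ?thesis by simp
  qed
  then have "card S = ?n * card {xs \<in> S. breaks E xs = 0}"
    using sum_card_rotations[OF fin len rot, of "\<lambda>xs. breaks E xs = 0"] by simp
  moreover have "{xs \<in> S. breaks E xs = 0} = ham_lists E V"
    using assms(3) by (auto simp: S_def ham_lists_def cyclic_breaks_def nonham_def)
  ultimately show ?thesis by (simp add: S_def)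
qed

text \<open>Both sides count the cyclic sequences with a single non-adjacent consecutive pair: cutting
  at that pair gives a Hamilton path, cutting at \<open>w\<close> gives a linear sequence with one defect.\<close>

lemma card_ham_lists_eq_one_defect:
  assumes "symp E" "finite V" "w \<in> V" "card V \<ge> 2" "nonham E V"
  shows "card (ham_lists E V) = card (one_defect E (V - {w}) (nbhd E V w) (nbhd E V w))"
proof -
  let ?n = "card V"
  define S where "S = {xs \<in> permutations_of_set V. cyclic_breaks E xs = 1}"
  have fin: "finite S" using assms(2) by (simp add: S_def)
  have len: "length xs = ?n" if "xs \<in> S" for xs using that by (simp add: S_def length_permutation)
  have rot: "rotate i xs \<in> S" if "xs \<in> S" for xs i
    using that by (simp add: S_def rotate_permutation cyclic_breaks_rotate)
  have "card {i. i < ?n \<and> hd (rotate i xs) = w} = 1" if xs: "xs \<in> S" for xs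
  proof -
    have p: "distinct xs" "set xs = V" "length xs = ?n" using xs len by (auto simp: S_def permutations_of_set_def)
    obtain i where i: "i < ?n" "xs ! i = w" using p assms(3) by (metis in_set_conv_nth)
    have "hd (rotate j xs) = xs ! j" if "j < ?n" for j
    proof -
      have "xs \<noteq> []" using that p(3) by auto
      then show ?thesis using that p(3) by (simp add: hd_rotate_conv_nth)
    qed
    then have "{i. i < ?n \<and> hd (rotate i xs) = w} = {j. j < ?n \<and> xs ! j = w}" by auto
    also have "\<dots> = {i}" using i p by (auto simp: nth_eq_iff_index_eq)
    finally show ?thesis by simp
  qed
  then have "card S = ?n * card {xs \<in> S. hd xs = w}"
    using sum_card_rotations[OF fin len rot, of "\<lambda>xs. hd xs = w"] by simp
  then have 3: "card (ham_lists E V) = card {xs \<in> S. hd xs = w}"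
    using card_single_cyclic_break[OF assms(2,4,5)] assms(4) by (simp add: S_def)
  have ne: "[] \<notin> permutations_of_set V" using assms(3) by (auto simp: permutations_of_set_def)
  have ne': "ys \<noteq> []" if "ys \<in> permutations_of_set (V - {w})" for ys
    using that Diff_singleton_nonempty[OF assms(3,4)] by (metis list.set(1) permutations_of_setD(1))
  have "{xs \<in> S. hd xs = w} = (#) w ` {ys. w # ys \<in> S}"
    using ne by (auto simp: image_iff S_def) (metis list.exhaust_sel)
  also have "{ys. w # ys \<in> S} = one_defect E (V - {w}) (nbhd E V w) (nbhd E V w)"
    using cyclic_breaks_Cons[OF assms(1,3) _ ne']
    by (auto simp: S_def one_defect_def Cons_permutation_iff[OF assms(3)])
  finally show ?thesis using 3 by (simp add: card_image)
qed

text \<open>Write the path as \<open>x_0, ..., x_(n-1)\<close>. If \<open>x_0\<close> is adjacent to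
  \<open>x_(i+1)\<close> and \<open>x_i\<close> to \<open>x_(n-1)\<close>, then reversing the part
  behind \<open>x_i\<close> closes a Hamilton cycle. So the index sets of these two kinds of chords
  are disjoint subsets of \<open>{..<n - 1}\<close>.\<close>

lemma ore:
  assumes "symp E" "finite V" "nonham E V" "xs \<in> ham_lists E V" "xs \<noteq> []"
  shows "card (nbhd E V (hd xs)) + card (nbhd E V (last xs)) \<le> card V - 1"
proof -
  let ?n = "card V"
  have p: "distinct xs" "set xs = V" "length xs = ?n" "breaks E xs = 0"
    using assms(4) by (auto simp: ham_lists_def permutations_of_set_def distinct_card)
  define A where "A = {i. i < ?n - 1 \<and> E (xs ! 0) (xs ! Suc i)}"
  define B where "B = {i. i < ?n - 1 \<and> E (xs ! i) (xs ! (?n - 1))}"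
  have "nbhd E V (hd xs) \<subseteq> (\<lambda>i. xs ! Suc i) ` A"
  proof
    fix v assume "v \<in> nbhd E V (hd xs)"
    then have v: "v \<in> V" "v \<noteq> xs ! 0" "E (xs ! 0) v" using assms(5) by (auto simp: nbhd_def hd_conv_nth)
    then obtain j where j: "j < ?n" "xs ! j = v" using p by (metis in_set_conv_nth)
    with v show "v \<in> (\<lambda>i. xs ! Suc i) ` A" by (cases j) (auto simp: A_def)
  qed
  then have a: "card (nbhd E V (hd xs)) \<le> card A"
    by (rule surj_card_le[rotated]) (simp add: A_def)
  have "nbhd E V (last xs) \<subseteq> (\<lambda>i. xs ! i) ` B"
  proof
    fix v assume "v \<in> nbhd E V (last xs)"
    then have v: "v \<in> V" "v \<noteq> xs ! (?n - 1)" "E v (xs ! (?n - 1))"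
      using assms(1,5) p by (auto simp: nbhd_def last_conv_nth dest: sympD)
    then obtain j where j: "j < ?n" "xs ! j = v" using p by (metis in_set_conv_nth)
    moreover have "j \<noteq> ?n - 1" using j v by auto
    ultimately show "v \<in> (\<lambda>i. xs ! i) ` B" using v by (auto simp: B_def)
  qed
  then have b: "card (nbhd E V (last xs)) \<le> card B"
    by (rule surj_card_le[rotated]) (simp add: B_def)
  have "A \<inter> B = {}"
  proof (rule ccontr)
    assume "A \<inter> B \<noteq> {}"
    then obtain i where i: "i < ?n - 1" "E (xs ! 0) (xs ! Suc i)" "E (xs ! i) (xs ! (?n - 1))"
      by (auto simp: A_def B_def)
    define ys zs where "ys = take (Suc i) xs" and "zs = drop (Suc i) xs"
    have yz: "xs = ys @ zs" "ys \<noteq> []" "zs \<noteq> []"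
      using i p(3) assms(5) by (auto simp: ys_def zs_def)
    have ends: "hd ys = xs ! 0" "last ys = xs ! i" "hd zs = xs ! Suc i" "last zs = xs ! (?n - 1)"
    proof -
      have l: "Suc i < length xs" using i(1) p(3) by linarith
      show "hd ys = xs ! 0" using assms(5) by (simp add: ys_def hd_conv_nth)
      show "last ys = xs ! i" using l yz(2) by (simp add: ys_def last_conv_nth min_absorb2)
      show "hd zs = xs ! Suc i" using l by (simp add: zs_def hd_drop_conv_nth)
      show "last zs = xs ! (?n - 1)" using yz(1,3) assms(5) p(3) last_conv_nth[of xs] by simp
    qed
    have "breaks E ys = 0" "breaks E zs = 0"
      using p(4) yz breaks_append[of ys zs E] by simp_all
    then have "cyclic_breaks E (ys @ rev zs) = 0"
      using i yz ends assms(1)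
      by (auto simp: cyclic_breaks_def breaks_append breaks_rev hd_rev last_rev dest: sympD)
    moreover have "ys @ rev zs \<in> permutations_of_set V"
      using p(1,2) yz by (auto simp: permutations_of_set_def)
    ultimately show False using assms(3) unfolding nonham_def by blast
  qed
  then have "card A + card B = card (A \<union> B)"
    by (subst card_Un_disjoint) (auto simp: A_def B_def)
  also have "\<dots> \<le> card {..<?n - 1}" by (rule card_mono) (auto simp: A_def B_def)
  finally show ?thesis using a b by simp
qed

text \<open>If \<open>card L + 2 \<le> card U\<close>, the factor \<open>card L + 1\<close> is at
  most \<open>card U - 1\<close>, exactly what lifts the bound \<open>2 * fact (card U - 2)\<close>
  for the tails to \<open>2 * fact (card U - 1)\<close>. The tails have nonempty end sets unless
  some vertex is isolated or \<open>R\<close> is a singleton, and those cases are settled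
  directly.\<close>

lemma card_one_defect_step:
  assumes "symp E" "finite U" "L \<subseteq> U" "R \<subseteq> U" "L \<noteq> {}" "R \<noteq> {}" "no_linkage E U L R" "card U \<ge> 2"
    and IH: "\<And>u. \<lbrakk>u \<in> L; nbhd E U u \<noteq> {}; R - {u} \<noteq> {}\<rbrakk> \<Longrightarrow>
      card (one_defect E (U - {u}) (nbhd E U u) (R - {u})) \<le> 2 * fact (card U - 2)"
    and small: "card L = 1 \<or> card L + 2 \<le> card U"
  shows "card (one_defect E U L R) \<le> 2 * fact (card U - 1)"
proof -
  have ne: "U \<noteq> {}" using assms(8) by auto
  consider "card L = 1" | "card R = 1" | u where "u \<in> U" "nbhd E U u = {}"
    | "card L + 2 \<le> card U" "card R \<noteq> 1" "\<And>u. u \<in> U \<Longrightarrow> nbhd E U u \<noteq> {}"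
    using small by blast
  then show ?thesis
  proof cases
    case 1 then show ?thesis using card_one_defect_singleton[OF assms(1,2,7,3)] by blast
  next
    case 2 then show ?thesis
      using card_one_defect_singleton[OF assms(1,2), of R L] card_one_defect_swap[OF assms(1) ne, of L R]
        no_linkage_swap[OF assms(1) ne] assms by auto
  next
    case 3 then show ?thesis using card_one_defect_isolated[OF assms(1,2)] by blast
  next
    case 4
    have "R - {u} \<noteq> {}" for u
      using 4(2) assms(6) by (metis Diff_eq_empty_iff card_1_singleton_iff subset_singletonD One_nat_def)
    then have "card {xs \<in> one_defect E U L R. hd xs = u} \<le> 2 * fact (card U - 2)" if "u \<in> L" for u
      using IH[OF that] 4(3) card_one_defect_hd[OF that _ assms(8)] that assms(3) by auto
    then have "card (one_defect E U L R) \<le> (card L + 1) * (2 * fact (card U - 2))"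
      by (intro card_one_defect_le_of_tail assms)
    also have "\<dots> \<le> (card U - 1) * (2 * fact (card U - 2))"
      using 4(1) by (intro mult_le_mono1) simp
    also have "\<dots> = 2 * fact (card U - 1)"
      using assms(8) fact_reduce[of "card U - 1", where 'a = nat] by (simp add: numeral_2_eq_2 algebra_simps)
    finally show ?thesis .
  qed
qed

section \<open>The bound for orderings with one defect\<close>

text \<open>By \<open>ore\<close>, one of the two ends of a Hamilton path has at most half of
  \<open>card V - 1\<close> neighbours; it has at least one, its neighbour on the path.\<close>

lemma ham_lists_low_degree:
  assumes "symp E" "finite V" "nonham E V" "card V \<ge> 2" "ham_lists E V \<noteq> {}"
  obtains v where "v \<in> V" "nbhd E V v \<noteq> {}" "2 * card (nbhd E V v) \<le> card V - 1"
proof -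
  obtain xs where xs: "xs \<in> ham_lists E V" using assms(5) by blast
  then have p: "distinct xs" "set xs = V" "length xs = card V" "breaks E xs = 0"
    by (auto simp: ham_lists_def permutations_of_set_def distinct_card)
  obtain x y zs where l: "xs = x # y # zs"
    using p(3) assms(4) by (cases xs; cases "tl xs") auto
  have e: "nbhd E V v \<noteq> {}" if "v = hd xs \<or> v = last xs" for v
  proof -
    have "y \<in> nbhd E V x" using p l by (auto simp: nbhd_def)
    moreover have "breaks E (rev xs) = 0" using p(4) breaks_rev[OF assms(1)] by simp
    then have "rev xs ! 1 \<in> nbhd E V (rev xs ! 0)"
      using p l assms(4) breaks_eq_0_iff[of E "rev xs"] nth_mem[of 1 "rev xs"]
        nth_eq_iff_index_eq[of "rev xs" 1 0]
      by (auto simp: nbhd_def)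
    moreover have "rev xs ! 0 = last xs" using l by (metis hd_conv_nth hd_rev list.discI rev_is_Nil_conv)
    ultimately show ?thesis using that l by auto
  qed
  have "hd xs \<in> V" "last xs \<in> V" using p(2) l by auto
  moreover have "card (nbhd E V (hd xs)) + card (nbhd E V (last xs)) \<le> card V - 1"
    using ore[OF assms(1-3) xs] l by simp
  ultimately show ?thesis
    using that[of "hd xs"] that[of "last xs"] e
    by (cases "card (nbhd E V (hd xs)) \<le> card (nbhd E V (last xs))") auto
qed

lemma finite_nbhd [simp]: "finite V \<Longrightarrow> finite (nbhd E V v)"
  by (simp add: nbhd_def)

lemma nbhd_subset: "nbhd E V v \<subseteq> V - {v}"
  by (auto simp: nbhd_def)

text \<open>The number of Hamilton lists does not depend on the cutting vertex, so the cut may be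
  made at a vertex of small degree, where \<open>card_one_defect_step\<close> applies. The bound for
  the tails stays a hypothesis, since it is to be supplied from inside an induction.\<close>

lemma card_ham_lists_le_aux:
  assumes "symp E" "finite V" "nonham E V" "card V \<ge> 4"
    and IH: "\<And>v u. \<lbrakk>v \<in> V; u \<in> nbhd E V v; nbhd E (V - {v}) u \<noteq> {}; nbhd E V v - {u} \<noteq> {}\<rbrakk> \<Longrightarrow>
      card (one_defect E (V - {v} - {u}) (nbhd E (V - {v}) u) (nbhd E V v - {u})) \<le> 2 * fact (card V - 3)"
  shows "card (ham_lists E V) \<le> 2 * fact (card V - 2)"
proof (cases "ham_lists E V = {}")
  case False
  then obtain v where v: "v \<in> V" "nbhd E V v \<noteq> {}" "2 * card (nbhd E V v) \<le> card V - 1"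
    using ham_lists_low_degree[OF assms(1-3) _ False] assms(4) by auto
  have c: "card (V - {v}) = card V - 1" using v by simp
  have d: "card (nbhd E V v) \<noteq> 0" using v(2) assms(2) by simp
  have "card (one_defect E (V - {v}) (nbhd E V v) (nbhd E V v)) \<le> 2 * fact (card (V - {v}) - 1)"
  proof (rule card_one_defect_step[OF assms(1) _ nbhd_subset nbhd_subset v(2) v(2)])
    show "no_linkage E (V - {v}) (nbhd E V v) (nbhd E V v)"
      using nonham_iff_no_linkage[OF assms(1) v(1)] assms(3,4) by simp
    show "card (one_defect E (V - {v} - {u}) (nbhd E (V - {v}) u) (nbhd E V v - {u})) \<le> 2 * fact (card (V - {v}) - 2)"
      if "u \<in> nbhd E V v" "nbhd E (V - {v}) u \<noteq> {}" "nbhd E V v - {u} \<noteq> {}" for u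
    proof -
      have "card (V - {v}) - 2 = card V - 3" using c by simp
      then show ?thesis using IH[OF v(1) that] by simp
    qed
    \<comment> \<open>A degree \<open>d \<ge> 2\<close> satisfies
      \<open>d + 2 \<le> 2 * d \<le> card V - 1\<close>.\<close>
    show "card (nbhd E V v) = 1 \<or> card (nbhd E V v) + 2 \<le> card (V - {v})"
      using v(3) c d assms(4) by linarith
  qed (use assms c in auto)
  then show ?thesis
    using card_ham_lists_eq_one_defect[OF assms(1,2) v(1) _ assms(3)] c assms(4)
    by (simp add: numeral_2_eq_2)
qed simp

text \<open>An auxiliary vertex \<open>z\<close> joined exactly to \<open>L\<close> turns linkages from \<open>L\<close> to \<open>L\<close> into Hamilton
  cycles.\<close>

definition cone :: "('a \<Rightarrow> 'a \<Rightarrow> bool) \<Rightarrow> 'a \<Rightarrow> 'a set \<Rightarrow> 'a \<Rightarrow> 'a \<Rightarrow> bool" where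
  "cone E z L x y = (if x = z then y \<in> L else if y = z then x \<in> L else E x y)"

lemma symp_cone: "symp E \<Longrightarrow> symp (cone E z L)"
  by (auto simp: symp_def cone_def)

lemma breaks_cong:
  "(\<And>x y. x \<in> set xs \<Longrightarrow> y \<in> set xs \<Longrightarrow> E x y \<longleftrightarrow> E' x y) \<Longrightarrow> breaks E xs = breaks E' xs"
  by (auto simp: breaks_conv_sum intro!: sum.cong)

lemma defects_cone:
  assumes "z \<notin> U" "xs \<in> permutations_of_set U"
  shows "defects (cone E z L) A B xs = defects E A B xs"
proof -
  have "breaks (cone E z L) xs = breaks E xs"
    using assms by (intro breaks_cong) (auto simp: cone_def permutations_of_set_def)
  then show ?thesis by (simp add: defects_def)
qed

text \<open>Induction on \<open>card U\<close>, with \<open>E\<close> varying because cones change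
  the graph. The vertex \<open>z\<close> outside \<open>U\<close> is the apex for the cone; once a
  vertex has been deleted, it can play this role for the remaining ones.\<close>

lemma card_one_defect_le:
  assumes "symp E" "finite U" "z \<notin> U" "L \<subseteq> U" "R \<subseteq> U" "L \<noteq> {}" "R \<noteq> {}" "no_linkage E U L R"
  shows "card (one_defect E U L R) \<le> 2 * fact (card U - 1)"
  using assms
proof (induction "card U" arbitrary: U z L R E rule: less_induct)
  case less
  note IH = less(1) and prems = less(2-9)
  \<comment> \<open>Stated for any graph of the same size, so that it covers both \<open>U\<close>
    itself and the cone with some vertex \<open>v\<close> removed.\<close>
  have IH': "card (one_defect E' (U' - {u}) (nbhd E' U' u) (R' - {u})) \<le> 2 * fact (card U - 2)"
    if "symp E'" "finite U'" "card U' = card U" "card U' \<ge> 2" "L' \<subseteq> U'" "R' \<subseteq> U'" "no_linkage E' U' L' R'"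
      "u \<in> L'" "nbhd E' U' u \<noteq> {}" "R' - {u} \<noteq> {}" for E' :: "'a \<Rightarrow> 'a \<Rightarrow> bool" and U' L' R' u
  proof -
    have u: "u \<in> U'" using that by blast
    have c: "card (U' - {u}) = card U - 1" using that u by simp
    have lt: "card (U' - {u}) < card U" using c that(3,4) by linarith
    have "card (one_defect E' (U' - {u}) (nbhd E' U' u) (R' - {u})) \<le> 2 * fact (card (U' - {u}) - 1)"
    proof (rule IH[OF lt that(1) _ _ nbhd_subset _ that(9,10) no_linkage_tail[OF that(7,8) u that(4)]])
      show "finite (U' - {u})" using that(2) by simp
      show "u \<notin> U' - {u}" by simp
      show "R' - {u} \<subseteq> U' - {u}" using that(6) by blast
    qed
    then show ?thesis using c by (simp add: numeral_2_eq_2)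
  qed
  have ne: "U \<noteq> {}" using prems by blast
  \<comment> \<open>For equal end sets the cone restores a cyclic problem, which
    \<open>card_ham_lists_le_aux\<close> cuts open again at a vertex of small degree.\<close>
  have cyclic: "card (one_defect E U A A) \<le> 2 * fact (card U - 1)"
    if "A \<subseteq> U" "no_linkage E U A A" "card U \<ge> 3" for A
  proof -
    let ?V = "insert z U" and ?E = "cone E z A"
    have sym: "symp ?E" by (rule symp_cone[OF prems(1)])
    have c: "card ?V = card U + 1" using prems by simp
    have V: "?V - {z} = U" "z \<in> ?V" using prems(3) by auto
    have N: "nbhd ?E ?V z = A" using that prems(3) by (auto simp: nbhd_def cone_def)
    have c2: "card ?V \<ge> 2" using c that(3) by simp
    have nh: "nonham ?E ?V"
      using nonham_iff_no_linkage[OF sym V(2) c2] that(2) defects_cone[OF prems(3)]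
      unfolding V N no_linkage_def by simp
    have "card (ham_lists ?E ?V) \<le> 2 * fact (card ?V - 2)"
    proof (rule card_ham_lists_le_aux[OF sym _ nh])
      fix v u assume *: "v \<in> ?V" "u \<in> nbhd ?E ?V v" "nbhd ?E (?V - {v}) u \<noteq> {}" "nbhd ?E ?V v - {u} \<noteq> {}"
      have "card (one_defect ?E (?V - {v} - {u}) (nbhd ?E (?V - {v}) u) (nbhd ?E ?V v - {u})) \<le> 2 * fact (card U - 2)"
      proof (rule IH'[OF sym _ _ _ nbhd_subset nbhd_subset _ *(2,3,4)])
        show "card (?V - {v}) = card U" "2 \<le> card (?V - {v})" using *(1) c that(3) prems(2) by simp_all
        show "no_linkage ?E (?V - {v}) (nbhd ?E ?V v) (nbhd ?E ?V v)"
          using nonham_iff_no_linkage[OF sym *(1) c2] nh by simp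
      qed (use prems(2) in simp)
      then show "card (one_defect ?E (?V - {v} - {u}) (nbhd ?E (?V - {v}) u) (nbhd ?E ?V v - {u})) \<le> 2 * fact (card ?V - 3)"
        using c by (simp add: numeral_2_eq_2 numeral_3_eq_3)
    qed (use prems(2) c that(3) in auto)
    moreover have "card (ham_lists ?E ?V) = card (one_defect ?E U A A)"
      using card_ham_lists_eq_one_defect[OF sym _ V(2) c2 nh] prems(2) unfolding V N by simp
    moreover have "one_defect ?E U A A = one_defect E U A A"
      using defects_cone[OF prems(3)] by (auto simp: one_defect_def)
    ultimately show ?thesis using c by (simp add: numeral_2_eq_2)
  qed
  consider "card U \<le> 2" | "card U \<ge> 3" "card L + 2 \<le> card U" | "card U \<ge> 3" "card R + 2 \<le> card U"
    | "card U \<ge> 3" "card U < card L + 2" "card U < card R + 2"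
    by linarith
  then show ?case
  proof cases
    case 1
    have "card (one_defect E U L R) \<le> card (permutations_of_set U)"
      using prems(2) by (intro card_mono) (auto simp: one_defect_def)
    also have "\<dots> = fact (card U)" using prems(2) by simp
    also have "\<dots> \<le> 2 * fact (card U - 1)"
    proof -
      have "card U = 1 \<or> card U = 2" using 1 ne prems(2) card_gt_0_iff[of U] by linarith
      then show ?thesis by (auto simp: numeral_2_eq_2)
    qed
    finally show ?thesis .
  next
    case 2
    show ?thesis
    proof (rule card_one_defect_step[OF prems(1,2,4-8)])
      show "2 \<le> card U" using 2 by simp
      show "card (one_defect E (U - {u}) (nbhd E U u) (R - {u})) \<le> 2 * fact (card U - 2)"
        if "u \<in> L" "nbhd E U u \<noteq> {}" "R - {u} \<noteq> {}" for u
        using IH'[OF prems(1,2) refl _ prems(4,5,8) that] 2 by simp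
    qed (use 2 in simp)
  next
    case 3
    have nl: "no_linkage E U R L" using prems(8) no_linkage_swap[OF prems(1) ne] by blast
    have "card (one_defect E U R L) \<le> 2 * fact (card U - 1)"
    proof (rule card_one_defect_step[OF prems(1,2,5,4,7,6) nl])
      show "2 \<le> card U" using 3 by simp
      show "card (one_defect E (U - {u}) (nbhd E U u) (L - {u})) \<le> 2 * fact (card U - 2)"
        if "u \<in> R" "nbhd E U u \<noteq> {}" "L - {u} \<noteq> {}" for u
        using IH'[OF prems(1,2) refl _ prems(5,4) nl that] 3 by simp
    qed (use 3 in simp)
    then show ?thesis using card_one_defect_swap[OF prems(1) ne, of L R] by simp
  next
    case 4
    show ?thesis
    proof (cases "L = R")
      case True
      then show ?thesis using cyclic[of L] prems 4 by simp
    next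
      case False
      have miss: "x = y" if "x \<in> U - A" "y \<in> U - A" "A \<subseteq> U" "card U < card A + 2" for x y A
      proof -
        have "card (U - A) \<le> 1"
          using that prems(2) card_Diff_subset[of A U] finite_subset[of A U] by simp
        then show ?thesis using that prems(2) by (metis card_le_Suc0_iff_eq finite_Diff One_nat_def)
      qed
      \<comment> \<open>\<open>L\<close> and \<open>R\<close> each miss at most one vertex. As
        neither \<open>xs\<close> nor its reversal is a linkage and the two ends differ, both sets
        would have to miss the same end, which forces \<open>L = R\<close>.\<close>
      have nontrace: "breaks E xs \<noteq> 0" if xs: "xs \<in> permutations_of_set U" for xs
      proof
        assume b: "breaks E xs = 0"
        have p: "distinct xs" "set xs = U" "xs \<noteq> []" "length xs = card U"
          using xs ne by (auto simp: permutations_of_set_def distinct_card)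
        have neq: "hd xs \<noteq> last xs"
          using p 4(1) by (cases xs) (auto split: if_splits)
        have "hd xs \<in> U" "last xs \<in> U" using p by auto
        moreover have "defects E L R xs \<noteq> 0" "defects E L R (rev xs) \<noteq> 0"
          using prems(8) xs rev_permutation_iff[of xs U] by (auto simp: no_linkage_def)
        then have "hd xs \<notin> L \<or> last xs \<notin> R" "last xs \<notin> L \<or> hd xs \<notin> R"
          using b p(3) breaks_rev[OF prems(1), of xs] by (auto simp: defects_def hd_rev last_rev)
        moreover have "L = R" if "x \<in> U - L" "x \<in> U - R" for x
        proof -
          have "U - L = {x}" "U - R = {x}"
            using that miss[OF _ _ prems(4) 4(2)] miss[OF _ _ prems(5) 4(3)] by blast+
          then show ?thesis using prems(4,5) by blast
        qed
        ultimately show False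
          using neq False miss[OF _ _ prems(4) 4(2)] miss[OF _ _ prems(5) 4(3)] by blast
      qed
      \<comment> \<open>Every ordering now has a break, so that the single defect of an ordering
        counted for \<open>L\<close> and \<open>R\<close> is a break. Both end sets may therefore be
        enlarged to \<open>U\<close>.\<close>
      have "no_linkage E U U U" using nontrace by (simp add: no_linkage_def defects_def)
      then have "card (one_defect E U U U) \<le> 2 * fact (card U - 1)" using cyclic[of U] 4(1) by simp
      moreover have "one_defect E U L R \<subseteq> one_defect E U U U"
      proof
        fix xs assume xs: "xs \<in> one_defect E U L R"
        then have p: "xs \<in> permutations_of_set U" by (simp add: one_defect_def)
        then have "set xs = U" "xs \<noteq> []" using ne by (auto simp: permutations_of_set_def)
        then have "hd xs \<in> U" "last xs \<in> U" by auto
        then show "xs \<in> one_defect E U U U"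
          using xs nontrace[OF p] by (auto simp: one_defect_def defects_def split: if_splits)
      qed
      ultimately show ?thesis
        using card_mono[of "one_defect E U U U" "one_defect E U L R"] prems(2) by simp
    qed
  qed
qed

section \<open>Counting path lists\<close>

definition path_lists :: "('a \<Rightarrow> 'a \<Rightarrow> bool) \<Rightarrow> 'a set \<Rightarrow> nat \<Rightarrow> 'a list set" where
  "path_lists E V k = {xs. distinct xs \<and> set xs \<subseteq> V \<and> length xs = Suc k \<and> breaks E xs = 0}"

lemma finite_path_lists [simp]: "finite V \<Longrightarrow> finite (path_lists E V k)"
  unfolding path_lists_def
  by (rule finite_subset[OF _ finite_lists_length_eq[of V "Suc k"]]) auto

lemma card_permutations_path_prefix:
  assumes "finite V" "k < card V"
  shows "card {xs \<in> permutations_of_set V. breaks E (take (Suc k) xs) = 0}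
           = card (path_lists E V k) * fact (card V - Suc k)"
proof -
  have "bij_betw (\<lambda>(ys, zs). ys @ zs) (SIGMA ys:path_lists E V k. permutations_of_set (V - set ys))
      {xs \<in> permutations_of_set V. breaks E (take (Suc k) xs) = 0}"
  proof (rule bij_betwI[where g = "\<lambda>xs. (take (Suc k) xs, drop (Suc k) xs)"], goal_cases)
    case 1
    then show ?case by (auto simp: path_lists_def permutations_of_set_def)
  next
    case 2
    show ?case
    proof
      fix xs assume xs: "xs \<in> {xs \<in> permutations_of_set V. breaks E (take (Suc k) xs) = 0}"
      then have p: "set xs = V" "distinct xs" "length xs = card V"
        by (auto simp: permutations_of_set_def distinct_card)
      have "set (take (Suc k) xs) \<inter> set (drop (Suc k) xs) = {}"
        using p(2) by (simp add: set_take_disj_set_drop_if_distinct)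
      moreover have "set (take (Suc k) xs) \<union> set (drop (Suc k) xs) = V"
        using p(1) by (metis append_take_drop_id set_append)
      ultimately have "set (drop (Suc k) xs) = V - set (take (Suc k) xs)" by blast
      then show "(take (Suc k) xs, drop (Suc k) xs) \<in> (SIGMA ys:path_lists E V k. permutations_of_set (V - set ys))"
        using p xs assms(2) set_take_subset[of "Suc k" xs]
        by (simp add: path_lists_def permutations_of_set_def)
    qed
  qed (auto simp: path_lists_def)
  then have "card {xs \<in> permutations_of_set V. breaks E (take (Suc k) xs) = 0} =
      card (SIGMA ys:path_lists E V k. permutations_of_set (V - set ys))"
    by (simp add: bij_betw_same_card)
  also have "\<dots> = (\<Sum>ys\<in>path_lists E V k. card (permutations_of_set (V - set ys)))"
    using assms(1) by (subst card_SigmaI) auto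
  also have "\<dots> = (\<Sum>ys\<in>path_lists E V k. fact (card V - Suc k))"
  proof (rule sum.cong[OF refl])
    fix ys assume "ys \<in> path_lists E V k"
    then have "card (V - set ys) = card V - Suc k"
      using assms(1) by (auto simp: path_lists_def card_Diff_subset distinct_card)
    then show "card (permutations_of_set (V - set ys)) = fact (card V - Suc k)" using assms(1) by simp
  qed
  finally show ?thesis by simp
qed

text \<open>Averaging over rotations: a permutation has at most \<open>card V - k - 1\<close> good
  rotations, or one more if it has a single cyclic break. The permutations of the latter kind number
  \<open>card V\<close> times the Hamilton lists, so a factor \<open>card V\<close> cancels. The
  factorial on the left counts the ways to complete a path list to a permutation.\<close>

lemma card_path_lists_le:
  assumes "finite V" "nonham E V" "1 \<le> k" "k < card V"
  shows "card (path_lists E V k) * fact (card V - Suc k)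
           \<le> (card V - k - 1) * fact (card V - 1) + card (ham_lists E V)"
proof -
  let ?n = "card V" and ?P = "permutations_of_set V"
  have "?n * (card (path_lists E V k) * fact (?n - Suc k)) =
      ?n * card {xs \<in> ?P. breaks E (take (Suc k) xs) = 0}"
    using card_permutations_path_prefix[OF assms(1,4)] by simp
  also have "\<dots> = (\<Sum>xs\<in>?P. card {i. i < ?n \<and> breaks E (take (Suc k) (rotate i xs)) = 0})"
    by (rule sum_card_rotations[symmetric]) (simp_all add: length_permutation rotate_permutation)
  also have "\<dots> \<le> (\<Sum>xs\<in>?P. (?n - k - 1) + of_bool (cyclic_breaks E xs = 1))"
  proof (rule sum_mono)
    fix xs assume xs: "xs \<in> ?P"
    then have l: "length xs = ?n" by (rule length_permutation)
    then have ne: "xs \<noteq> []" using assms(4) by auto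
    have eq: "{i. i < ?n \<and> breaks E (take (Suc k) (rotate i xs)) = 0} = good_rotations E k xs"
      using l by (simp add: good_rotations_def)
    have "cyclic_breaks E xs \<noteq> 0" using assms(2) xs unfolding nonham_def by blast
    then consider "cyclic_breaks E xs = 1" | "cyclic_breaks E xs \<ge> 2" by linarith
    then show "card {i. i < ?n \<and> breaks E (take (Suc k) (rotate i xs)) = 0} \<le>
        (?n - k - 1) + of_bool (cyclic_breaks E xs = 1)"
    proof cases
      case 1
      then show ?thesis
        using card_good_rotations_one[of E xs k] cyclic_breaks_conv_card[OF ne, of E] l assms(4)
        unfolding eq by simp
    next
      case 2
      then show ?thesis
        using card_good_rotations_many[of E xs k] cyclic_breaks_conv_card[OF ne, of E] l assms(3,4)
        unfolding eq by simp
    qed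
  qed
  also have "\<dots> = (?n - k - 1) * fact ?n + card {xs \<in> ?P. cyclic_breaks E xs = 1}"
  proof -
    have "{xs \<in> ?P. cyclic_breaks E xs = 1} = ?P \<inter> {xs. cyclic_breaks E xs = 1}" by auto
    then show ?thesis using assms(1) by (simp add: sum.distrib of_bool_def sum.If_cases)
  qed
  also have "\<dots> = ?n * ((?n - k - 1) * fact (?n - 1) + card (ham_lists E V))"
    using card_single_cyclic_break[OF assms(1) _ assms(2)] assms(3,4) fact_reduce[of ?n, where 'a = nat]
    by (simp add: algebra_simps)
  finally show ?thesis using assms(4) by simp
qed

section \<open>The extremal graph: a clique with a pendant vertex \<open>w\<close> attached at
  \<open>u\<close>\<close>

definition pendant :: "('a \<Rightarrow> 'a \<Rightarrow> bool) \<Rightarrow> 'a set \<Rightarrow> 'a \<Rightarrow> 'a \<Rightarrow> bool" where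
  "pendant E V u w \<longleftrightarrow> u \<in> V \<and> w \<in> V \<and> u \<noteq> w \<and> nbhd E V w = {u} \<and>
     (\<forall>x \<in> V - {w}. \<forall>y \<in> V - {w}. x \<noteq> y \<longrightarrow> E x y)"

lemma permutation_with_prefix:
  assumes "finite U" "set ys \<subseteq> U" "distinct ys"
  obtains zs where "ys @ zs \<in> permutations_of_set U"
proof -
  obtain zs where "set zs = U - set ys" "distinct zs"
    using assms(1) finite_distinct_list[of "U - set ys"] by auto
  then have "ys @ zs \<in> permutations_of_set U"
    using assms by (auto simp: permutations_of_set_def)
  then show ?thesis using that by blast
qed

text \<open>Equality forces every ordering of the other vertices that starts at \<open>u\<close> to
  have exactly one defect. Its last vertex is not \<open>u\<close>, so that defect sits at the right
  end and the ordering has no break. Orderings with prescribed beginnings then exhibit every edge of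
  the clique.\<close>

lemma pendant_if_extremal_degree_one:
  assumes "symp E" "finite V" "card V \<ge> 3" "nonham E V" "w \<in> V" "nbhd E V w = {u}"
    and "card (ham_lists E V) \<ge> 2 * fact (card V - 2)"
  shows "pendant E V u w"
proof -
  let ?U = "V - {w}"
  let ?O = "one_defect E ?U {u} {u}"
  have u: "u \<in> ?U" using assms(6) by (auto simp: nbhd_def)
  have c: "card ?U = card V - 1" using assms(5) by simp
  have n2: "card V \<ge> 2" using assms(3) by simp
  have nl: "no_linkage E ?U {u} {u}"
    using nonham_iff_no_linkage[OF assms(1,5) n2] assms(4,6) by simp
  have finU: "finite ?U" using assms(2) by simp
  \<comment> \<open>At least half of the one-defect orderings start at \<open>u\<close>, and only
    \<open>fact (card ?U - 1)\<close> orderings do so at all.\<close>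
  have "card ?O \<le> (card {u} + 1) * card {xs \<in> ?O. hd xs = u}"
    using u by (intro card_one_defect_le_of_tail[OF assms(1) finU _ _ nl]) auto
  then have "fact (card ?U - 1) \<le> card {xs \<in> ?O. hd xs = u}"
    using assms(7) card_ham_lists_eq_one_defect[OF assms(1,2,5) n2 assms(4)] c assms(6)
    by (simp add: numeral_2_eq_2)
  moreover have sub: "{xs \<in> ?O. hd xs = u} \<subseteq> {xs \<in> permutations_of_set ?U. hd xs = u}"
    by (auto simp: one_defect_def)
  ultimately have all: "{xs \<in> ?O. hd xs = u} = {xs \<in> permutations_of_set ?U. hd xs = u}"
    using card_permutations_hd[OF finU u] by (intro card_seteq) auto
  have b: "breaks E xs = 0" if "xs \<in> permutations_of_set ?U" "hd xs = u" for xs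
  proof -
    have "xs \<in> ?O" using all that by blast
    moreover have "last xs \<noteq> u"
    proof -
      have p: "distinct xs" "length xs = card ?U"
        using that permutations_of_setD(2) length_permutation by blast+
      then have "length xs \<ge> 2" using c assms(3) by linarith
      then show ?thesis using p(1) that(2) by (cases xs) (auto split: if_splits)
    qed
    ultimately show ?thesis by (auto simp: one_defect_def defects_def)
  qed
  have E1: "E u y" if "y \<in> ?U" "y \<noteq> u" for y
  proof -
    have "set [u, y] \<subseteq> ?U" "distinct [u, y]" using that u by auto
    then obtain zs where "[u, y] @ zs \<in> permutations_of_set ?U"
      by (rule permutation_with_prefix[OF finU])
    then show ?thesis using b[of "[u, y] @ zs"] by (auto split: if_splits)
  qed
  have E2: "E x y" if "x \<in> ?U" "y \<in> ?U" "x \<noteq> u" "y \<noteq> u" "x \<noteq> y" for x y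
  proof -
    have "set [u, x, y] \<subseteq> ?U" "distinct [u, x, y]" using that u by auto
    then obtain zs where "[u, x, y] @ zs \<in> permutations_of_set ?U"
      by (rule permutation_with_prefix[OF finU])
    then show ?thesis using b[of "[u, x, y] @ zs"] by (auto split: if_splits)
  qed
  have "E x y" if "x \<in> ?U" "y \<in> ?U" "x \<noteq> y" for x y
    using E1 E2 that sympD[OF assms(1), of u x] by metis
  then show ?thesis using u assms(5,6) unfolding pendant_def by blast
qed

text \<open>Cutting at \<open>v\<close> and deleting one more vertex \<open>u\<close> leaves
  \<open>card V - 2\<close> vertices, to which \<open>card_one_defect_le\<close> applies. The
  minimum degree 2 keeps both end sets nonempty.\<close>

lemma card_ham_lists_le_degree:
  assumes "symp E" "finite V" "card V \<ge> 3" "nonham E V" "v \<in> V"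
    and "\<And>x. x \<in> V \<Longrightarrow> card (nbhd E V x) \<ge> 2"
  shows "card (ham_lists E V) \<le> (card (nbhd E V v) + 1) * (2 * fact (card V - 3))"
proof -
  let ?U = "V - {v}" and ?N = "nbhd E V v"
  have c: "card ?U = card V - 1" using assms(5) by simp
  have n2: "card V \<ge> 2" using assms(3) by simp
  have finU: "finite ?U" using assms(2) by simp
  have nl: "no_linkage E ?U ?N ?N"
    using nonham_iff_no_linkage[OF assms(1,5) n2] assms(4) by simp
  have "card {xs \<in> one_defect E ?U ?N ?N. hd xs = u} \<le> 2 * fact (card V - 3)" if u: "u \<in> ?N" for u
  proof -
    have uU: "u \<in> ?U" using u by (auto simp: nbhd_def)
    have "nbhd E V u \<subseteq> insert v (nbhd E ?U u)" by (auto simp: nbhd_def)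
    then have "card (nbhd E V u) \<le> card (insert v (nbhd E ?U u))" using assms(2) by (intro card_mono) auto
    then have 1: "nbhd E ?U u \<noteq> {}" using assms(6)[of u] uU by auto
    have 2: "?N - {u} \<noteq> {}" using Diff_singleton_nonempty[OF u assms(6)[OF assms(5)]] .
    have U2: "card ?U \<ge> 2" using c assms(3) by simp
    have sub: "?N - {u} \<subseteq> ?U - {u}" using nbhd_subset[of E V v] by blast
    have "card (one_defect E (?U - {u}) (nbhd E ?U u) (?N - {u})) \<le> 2 * fact (card (?U - {u}) - 1)"
      by (rule card_one_defect_le[OF assms(1) _ _ nbhd_subset sub 1 2 no_linkage_tail[OF nl u uU U2]])
        (use finU in auto)
    moreover have "card (?U - {u}) - 1 = card V - 3" using c uU by simp
    ultimately show ?thesis using card_one_defect_hd[OF u uU U2, of E ?N] by simp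
  qed
  moreover have "?N \<noteq> {}" using assms(6)[OF assms(5)] by auto
  ultimately have "card (one_defect E ?U ?N ?N) \<le> (card ?N + 1) * (2 * fact (card V - 3))"
    by (intro card_one_defect_le_of_tail[OF assms(1) finU nbhd_subset _ nl]) auto
  then show ?thesis using card_ham_lists_eq_one_defect[OF assms(1,2,5) n2 assms(4)] by simp
qed

lemma card_ham_lists_le:
  assumes "symp E" "finite V" "card V \<ge> 6" "nonham E V"
  shows "card (ham_lists E V) \<le> 2 * fact (card V - 2)"
    and "card (ham_lists E V) \<ge> 2 * fact (card V - 2) \<Longrightarrow> \<exists>u w. pendant E V u w"
proof -
  let ?n = "card V"
  have n2: "card V \<ge> 2" using assms(3) by simp
  have root: "card (ham_lists E V) = card (one_defect E (V - {w}) (nbhd E V w) (nbhd E V w))"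
    if "w \<in> V" for w
    using card_ham_lists_eq_one_defect[OF assms(1,2) that n2 assms(4)] .
  have fpos: "fact (?n - 2) > (0::nat)" by simp
  consider w where "w \<in> V" "nbhd E V w = {}" | w where "w \<in> V" "card (nbhd E V w) = 1"
    | "\<And>x. x \<in> V \<Longrightarrow> card (nbhd E V x) \<ge> 2"
  proof -
    have "card (nbhd E V x) \<ge> 2" if "nbhd E V x \<noteq> {}" "card (nbhd E V x) \<noteq> 1" for x
    proof -
      have "card (nbhd E V x) \<noteq> 0" using that(1) assms(2) by simp
      then show ?thesis using that(2) by linarith
    qed
    then show ?thesis using that by blast
  qed
  then have "card (ham_lists E V) \<le> 2 * fact (?n - 2) \<and>
    (card (ham_lists E V) \<ge> 2 * fact (?n - 2) \<longrightarrow> (\<exists>u w. pendant E V u w))"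
  proof cases
    case 1
    \<comment> \<open>With both end sets empty, every ordering has at least two defects.\<close>
    then have "card (ham_lists E V) = 0" using root[OF 1(1)] by (simp add: one_defect_def defects_def)
    then show ?thesis using fpos by simp
  next
    case 2
    then obtain u where u: "nbhd E V w = {u}" by (auto simp: card_1_singleton_iff)
    have nl: "no_linkage E (V - {w}) (nbhd E V w) (nbhd E V w)"
      using nonham_iff_no_linkage[OF assms(1) 2(1) n2] assms(4) by simp
    have "card (ham_lists E V) \<le> 2 * fact (card (V - {w}) - 1)"
      using card_one_defect_singleton[OF assms(1) _ nl nbhd_subset 2(2)] root[OF 2(1)] assms(2) by simp
    then have "card (ham_lists E V) \<le> 2 * fact (?n - 2)" using 2(1) by (simp add: numeral_2_eq_2)
    then show ?thesis
      using pendant_if_extremal_degree_one[OF assms(1,2) _ assms(4) 2(1) u] assms(3) by auto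
  next
    case 3
    have "card (ham_lists E V) < 2 * fact (?n - 2)"
    proof (cases "ham_lists E V = {}")
      case False
      then obtain v where v: "v \<in> V" "nbhd E V v \<noteq> {}" "2 * card (nbhd E V v) \<le> ?n - 1"
        using ham_lists_low_degree[OF assms(1,2,4) n2] by blast
      have "card (ham_lists E V) \<le> (card (nbhd E V v) + 1) * (2 * fact (?n - 3))"
        using card_ham_lists_le_degree[OF assms(1,2) _ assms(4) v(1) 3] assms(3) by simp
      \<comment> \<open>This is where \<open>?n \<ge> 6\<close> enters:
        \<open>2 * d \<le> ?n - 1\<close> yields \<open>d + 1 < ?n - 2\<close>, while for five
        vertices and \<open>d = 2\<close> the two sides agree.\<close>
      also have "\<dots> < (?n - 2) * (2 * fact (?n - 3))"
        using v(3) assms(3) by (intro mult_less_mono1) auto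
      also have "\<dots> = 2 * fact (?n - 2)"
      proof -
        have "?n - 2 = Suc (?n - 3)" using assms(3) by simp
        then show ?thesis by (simp only: fact_Suc of_nat_id mult.left_commute)
      qed
      finally show ?thesis .
    qed (use fpos in simp)
    then show ?thesis by simp
  qed
  then show "card (ham_lists E V) \<le> 2 * fact (?n - 2)"
    "card (ham_lists E V) \<ge> 2 * fact (?n - 2) \<Longrightarrow> \<exists>u w. pendant E V u w" by blast+
qed

text \<open>After cutting at \<open>w\<close>, a linkage would have to start and end at the same
  vertex \<open>u\<close>.\<close>

lemma pendant_nonham:
  assumes "symp E" "finite V" "card V \<ge> 3" "pendant E V u w"
  shows "nonham E V"
proof -
  have w: "w \<in> V" "nbhd E V w = {u}" and n2: "card V \<ge> 2" using assms by (auto simp: pendant_def)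
  have "defects E {u} {u} xs \<noteq> 0" if "xs \<in> permutations_of_set (V - {w})" for xs
  proof
    assume "defects E {u} {u} xs = 0"
    then have "hd xs = last xs" by (auto simp: defects_def)
    moreover have "distinct xs" "length xs = card V - 1"
      using permutations_of_setD(2)[OF that] length_permutation[OF that] w(1) by simp_all
    ultimately show False using assms(3) by (cases xs) (auto split: if_splits)
  qed
  then show ?thesis
    using nonham_iff_no_linkage[OF assms(1) w(1) n2] w(2) by (simp add: no_linkage_def)
qed

section \<open>Counting the paths of the extremal graph\<close>

lemma card_distinct_lists:
  assumes "finite A"
  shows "card {xs. distinct xs \<and> set xs \<subseteq> A \<and> length xs = k} = falling (card A) k"
proof (cases "k \<le> card A")
  case True
  have "{xs. distinct xs \<and> set xs \<subseteq> A \<and> length xs = k} = {xs. length xs = k \<and> distinct xs \<and> set xs \<subseteq> A}"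
    by auto
  then have "card {xs. distinct xs \<and> set xs \<subseteq> A \<and> length xs = k} = \<Prod>{card A - k + 1..card A}"
    using card_lists_distinct_length_eq[OF assms True] by simp
  also have "\<dots> = falling (card A) k"
    unfolding falling_def
    by (rule prod.reindex_bij_witness[of _ "\<lambda>i. card A - i" "\<lambda>j. card A - j"]) (use True in auto)
  finally show ?thesis .
next
  case False
  have "length xs \<le> card A" if "distinct xs" "set xs \<subseteq> A" for xs
    using that assms by (metis card_mono distinct_card)
  then have "{xs. distinct xs \<and> set xs \<subseteq> A \<and> length xs = k} = {}" using False by auto
  \<comment> \<open>The factor with index \<open>card A\<close> vanishes. This case arises for
    Hamilton paths, where lists of \<open>card V\<close> vertices avoiding \<open>w\<close> are
    counted.\<close>
  moreover have "falling (card A) k = 0"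
    using False by (auto simp: falling_def prod_zero_iff intro!: bexI[of _ "card A"])
  ultimately show ?thesis by (metis card.empty)
qed

text \<open>The lists avoiding \<open>w\<close> are arbitrary in the clique. A list containing
  \<open>w\<close> has it at an end, next to \<open>u\<close>; these are the lists in
  \<open>B\<close> and their reversals.\<close>

lemma card_path_lists_pendant:
  assumes "symp E" "finite V" "pendant E V u w" "1 \<le> k"
  shows "card (path_lists E V k) = falling (card V - 1) (Suc k) + 2 * falling (card V - 2) (k - 1)"
proof -
  have pw: "u \<in> V" "w \<in> V" "u \<noteq> w" "nbhd E V w = {u}" using assms(3) by (auto simp: pendant_def)
  have Ecl: "E x y" if "x \<in> V - {w}" "y \<in> V - {w}" "x \<noteq> y" for x y
    using assms(3) that by (auto simp: pendant_def)
  have Ew: "x = u" if "E w x" "x \<in> V" "x \<noteq> w" for x using pw(4) that by (auto simp: nbhd_def)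
  have Ewu: "E w u" using pw(4) by (auto simp: nbhd_def)
  have path: "breaks E xs = 0" if "distinct xs" "set xs \<subseteq> V - {w}" for xs
    unfolding breaks_eq_0_iff
  proof (intro allI impI)
    fix i assume i: "i < length xs - 1"
    then have l: "i < length xs" "Suc i < length xs" by simp_all
    have "xs ! i \<noteq> xs ! Suc i" using nth_eq_iff_index_eq[OF that(1) l] by simp
    then show "E (xs ! i) (xs ! Suc i)"
      by (rule Ecl[OF subsetD[OF that(2) nth_mem[OF l(1)]] subsetD[OF that(2) nth_mem[OF l(2)]]])
  qed
  define A where "A = {xs. distinct xs \<and> set xs \<subseteq> V - {w} \<and> length xs = Suc k}"
  define T where "T = {zs. distinct zs \<and> set zs \<subseteq> V - {w, u} \<and> length zs = k - 1}"
  define B where "B = (\<lambda>zs. w # u # zs) ` T"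
  have revP: "rev xs \<in> path_lists E V k" if "xs \<in> path_lists E V k" for xs
    using that breaks_rev[OF assms(1)] by (simp add: path_lists_def)
  have B_iff: "xs \<in> B" if xs_in: "xs \<in> path_lists E V k" and hd: "hd xs = w" for xs
  proof -
    have "length xs \<ge> 2" using xs_in assms(4) by (simp add: path_lists_def)
    then obtain v zs where xs: "xs = w # v # zs"
      using hd by (cases xs; cases "tl xs") auto
    then have "v = u" using xs_in Ew by (auto simp: path_lists_def split: if_splits)
    then show ?thesis using xs xs_in by (auto simp: B_def T_def path_lists_def intro!: imageI)
  qed
  have "B \<subseteq> path_lists E V k"
  proof
    fix xs assume "xs \<in> B"
    then obtain zs where zs: "xs = w # u # zs" "distinct zs" "set zs \<subseteq> V - {w, u}" "length zs = k - 1"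
      by (auto simp: B_def T_def)
    have "breaks E (u # zs) = 0" using zs pw by (intro path) auto
    then show "xs \<in> path_lists E V k"
      using zs pw Ewu assms(4) by (auto simp: path_lists_def)
  qed
  moreover have "A \<subseteq> path_lists E V k" using path by (auto simp: A_def path_lists_def)
  moreover have "path_lists E V k \<subseteq> A \<union> B \<union> rev ` B"
  proof
    fix xs assume xs: "xs \<in> path_lists E V k"
    show "xs \<in> A \<union> B \<union> rev ` B"
    proof (cases "w \<in> set xs")
      case False
      then show ?thesis using xs by (auto simp: A_def path_lists_def)
    next
      case True
      then obtain as bs where ab: "xs = as @ w # bs" by (meson split_list)
      have p: "distinct xs" "set xs \<subseteq> V" "breaks E xs = 0" using xs by (auto simp: path_lists_def)
      show ?thesis
      proof (cases "as = [] \<or> bs = []")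
        case True
        then show ?thesis
        proof
          assume "as = []"
          then show ?thesis using B_iff[OF xs] ab by simp
        next
          assume "bs = []"
          then have "rev xs \<in> B" using B_iff[OF revP[OF xs]] ab by simp
          then show ?thesis by (metis UnI2 imageI rev_rev_ident)
        qed
      next
        case False
        \<comment> \<open>In an interior position \<open>w\<close> would have \<open>u\<close> on
          both sides, contradicting distinctness.\<close>
        have "breaks E (as @ w # bs) = 0" using p(3) ab by simp
        then have "E (last as) w" "E w (hd bs)"
          using False by (auto simp: breaks_append breaks_Cons split: if_splits)
        moreover have "last as \<in> set as" "hd bs \<in> set bs" using False by auto
        moreover have "last as \<in> V" "hd bs \<in> V" "last as \<noteq> w" "hd bs \<noteq> w"
          using calculation(3,4) p(1,2) ab by auto
        ultimately have "last as = u" "hd bs = u"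
          using Ew[of "hd bs"] Ew[of "last as"] sympD[OF assms(1), of "last as" w] by blast+
        then show ?thesis using p(1) ab \<open>last as \<in> set as\<close> \<open>hd bs \<in> set bs\<close> by auto
      qed
    qed
  qed
  moreover have "rev ` B \<subseteq> path_lists E V k" using revP \<open>B \<subseteq> path_lists E V k\<close> by auto
  ultimately have eq: "path_lists E V k = (A \<union> B) \<union> rev ` B" by blast
  have fT: "finite T" unfolding T_def
    by (rule finite_subset[OF _ finite_lists_length_eq[of V "k - 1"]]) (use assms(2) in auto)
  have fA: "finite A" unfolding A_def
    by (rule finite_subset[OF _ finite_lists_length_eq[of V "Suc k"]]) (use assms(2) in auto)
  have fB: "finite B" using fT by (simp add: B_def)
  have "A \<inter> B = {}" by (auto simp: A_def B_def)
  moreover have "(A \<union> B) \<inter> rev ` B = {}"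
  proof -
    have "w \<in> set xs" "last xs \<noteq> w" if "xs \<in> B" for xs
      using that pw(3) by (auto simp: B_def T_def split: if_splits)
        (metis Diff_iff in_mono insertI1 last_in_set)
    moreover have "last xs = w" "w \<in> set xs" if "xs \<in> rev ` B" for xs
      using that by (auto simp: B_def)
    ultimately show ?thesis unfolding A_def by blast
  qed
  ultimately have "card (path_lists E V k) = card A + card B + card (rev ` B)"
    unfolding eq using fA fB by (simp add: card_Un_disjoint)
  moreover have "card (rev ` B) = card B" by (simp add: card_image)
  moreover have "card B = card T" unfolding B_def by (rule card_image) (auto intro: inj_onI)
  moreover have "card T = falling (card V - 2) (k - 1)"
  proof -
    have "card (V - {w, u}) = card V - 2" using pw assms(2) by (simp add: card_Diff_subset)
    then show ?thesis using card_distinct_lists[of "V - {w, u}" "k - 1"] assms(2) by (simp add: T_def)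
  qed
  moreover have "card A = falling (card V - 1) (Suc k)"
    using card_distinct_lists[of "V - {w}" "Suc k"] assms(2) pw(2) by (simp add: A_def)
  ultimately show ?thesis by simp
qed

section \<open>Graphs\<close>

definition adj :: "'a ugraph \<Rightarrow> 'a \<Rightarrow> 'a \<Rightarrow> bool" where
  "adj G u v \<longleftrightarrow> {u, v} \<in> edges G"

lemma symp_adj: "symp (adj G)"
  by (auto simp: symp_def adj_def insert_commute)

lemma adj_irrefl: "simple_graph G \<Longrightarrow> \<not> adj G x x"
  by (force simp: simple_graph_def adj_def)

section \<open>Paths as vertex lists and as subgraphs\<close>

definition pedges :: "'a list \<Rightarrow> 'a set set" where
  "pedges xs = {{xs ! i, xs ! Suc i} | i. Suc i < length xs}"

lemma pedges_Cons: "ys \<noteq> [] \<Longrightarrow> pedges (x # ys) = insert {x, hd ys} (pedges ys)"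
proof (intro equalityI subsetI)
  fix e assume ys: "ys \<noteq> []" "e \<in> pedges (x # ys)"
  then obtain i where i: "e = {(x # ys) ! i, (x # ys) ! Suc i}" "Suc i < length (x # ys)"
    by (auto simp: pedges_def)
  then show "e \<in> insert {x, hd ys} (pedges ys)"
    using ys(1) by (cases i) (auto simp: pedges_def hd_conv_nth)
next
  fix e assume ys: "ys \<noteq> []" "e \<in> insert {x, hd ys} (pedges ys)"
  then consider "e = {x, hd ys}" | i where "e = {ys ! i, ys ! Suc i}" "Suc i < length ys"
    by (auto simp: pedges_def)
  then show "e \<in> pedges (x # ys)"
  proof cases
    case 1
    then have "e = {(x # ys) ! 0, (x # ys) ! Suc 0} \<and> Suc 0 < length (x # ys)"
      using ys(1) by (simp add: hd_conv_nth)
    then show ?thesis unfolding pedges_def by blast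
  next
    case 2
    then have "e = {(x # ys) ! Suc i, (x # ys) ! Suc (Suc i)} \<and> Suc (Suc i) < length (x # ys)" by simp
    then show ?thesis unfolding pedges_def by blast
  qed
qed

lemma pedges_single [simp]: "pedges [x] = {}"
  by (simp add: pedges_def)

lemma pedges_subset: "e \<in> pedges xs \<Longrightarrow> e \<subseteq> set xs"
  by (auto simp: pedges_def)

lemma pedges_append: "as \<noteq> [] \<Longrightarrow> bs \<noteq> [] \<Longrightarrow> {last as, hd bs} \<in> pedges (as @ bs)"
proof (induction as)
  case (Cons a as)
  then show ?case by (cases "as = []") (auto simp: pedges_Cons)
qed simp

lemma pedges_rev: "pedges (rev xs) = pedges xs"
proof -
  have "pedges (rev xs) \<subseteq> pedges xs" for xs :: "'a list"
  proof
    fix e assume "e \<in> pedges (rev xs)"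
    then obtain i where i: "e = {rev xs ! i, rev xs ! Suc i}" "Suc i < length xs"
      by (auto simp: pedges_def)
    define j where "j = length xs - Suc (Suc i)"
    have "Suc j = length xs - Suc i" using i(2) by (simp add: j_def)
    then have "e = {xs ! j, xs ! Suc j} \<and> Suc j < length xs"
      using i by (auto simp: rev_nth j_def insert_commute)
    then show "e \<in> pedges xs" unfolding pedges_def by blast
  qed
  from this[of xs] this[of "rev xs"] show ?thesis by auto
qed

text \<open>The only edge containing the first vertex \<open>x\<close> is the first one. It
  determines the next vertex, and removing it leaves the edge sets of the tails.\<close>

lemma pedges_inj_same_hd:
  assumes "distinct (x # xs)" "distinct (x # ys)" "pedges (x # xs) = pedges (x # ys)"
  shows "xs = ys"
  using assms
proof (induction xs arbitrary: x ys)
  case Nil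
  then show ?case by (cases ys) (auto simp: pedges_Cons)
next
  case (Cons a xs)
  obtain b zs where ys: "ys = b # zs" using Cons.prems(3) by (cases ys) (auto simp: pedges_Cons)
  have eq: "insert {x, a} (pedges (a # xs)) = insert {x, b} (pedges (b # zs))"
    using Cons.prems(3) ys by (simp add: pedges_Cons)
  have no: "{x, c} \<notin> pedges (a # xs)" "{x, c} \<notin> pedges (b # zs)" for c
    using Cons.prems(1,2) ys pedges_subset[of "{x, c}" "a # xs"] pedges_subset[of "{x, c}" "b # zs"] by auto
  have "{x, a} = {x, b}" using eq no by blast
  then have ab: "a = b" by (auto simp: doubleton_eq_iff)
  have "pedges (a # xs) = pedges (a # zs)"
    using insert_ident[OF no(1)[of a] no(2)[of a]] eq ab by simp
  then have "xs = zs" using Cons.IH[of a zs] Cons.prems(1,2) ys ab by simp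
  then show ?case using ys ab by simp
qed

text \<open>The first vertex of \<open>ys\<close> lies on one edge only. In the interior of
  \<open>xs\<close> it would have two different neighbours, so it is an end of
  \<open>xs\<close>.\<close>

lemma pedges_eq_imp:
  assumes "distinct xs" "distinct ys" "set xs = set ys" "length ys \<ge> 2" "pedges xs = pedges ys"
  shows "ys = xs \<or> ys = rev xs"
proof -
  obtain a y zs where ys: "ys = a # y # zs" using assms(4) by (cases ys; cases "tl ys") auto
  have nb: "b = y" if "{a, b} \<in> pedges xs" for b
  proof -
    have "{a, b} \<noteq> e" if "e \<in> pedges (y # zs)" for e
      using pedges_subset[OF that] assms(2) ys by auto
    then have "{a, b} = {a, y}" using that assms(5) ys by (auto simp: pedges_Cons)
    then show ?thesis by (auto simp: doubleton_eq_iff)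
  qed
  have "a \<in> set xs" using assms(3) ys by simp
  then obtain as bs where ab: "xs = as @ a # bs" by (meson split_list)
  have "as = [] \<or> bs = []"
  proof (rule ccontr)
    assume ne: "\<not> (as = [] \<or> bs = [])"
    have "{last as, a} \<in> pedges xs" using pedges_append[of as "a # bs"] ne ab by simp
    then have 1: "last as = y" using nb[of "last as"] by (simp add: insert_commute)
    have "{a, hd bs} \<in> pedges xs" using pedges_append[of "as @ [a]" bs] ne ab by simp
    then have 2: "hd bs = y" using nb by simp
    have "last as \<in> set as" "hd bs \<in> set bs" using ne by auto
    then show False using 1 2 assms(1) ab by auto
  qed
  then show ?thesis
  proof
    assume "as = []"
    then show ?thesis using pedges_inj_same_hd[of a bs "y # zs"] assms ab ys by simp
  next
    assume "bs = []"
    then have r: "rev xs = a # rev as" using ab by simp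
    have "distinct (rev xs)" using assms(1) by simp
    then have "rev as = y # zs"
      using pedges_inj_same_hd[of a "rev as" "y # zs"] assms(2,5) pedges_rev[of xs] unfolding r ys by metis
    then show ?thesis using r ys by simp
  qed
qed

lemma breaks_adj_iff: "breaks (adj G) xs = 0 \<longleftrightarrow> pedges xs \<subseteq> edges G"
  by (auto simp: breaks_eq_0_iff pedges_def adj_def less_diff_conv)

definition list_graph :: "'a list \<Rightarrow> 'a ugraph" where
  "list_graph xs = Graph (set xs) (pedges xs)"

lemma path_subgraphs_eq:
  assumes "simple_graph G"
  shows "{H. subgraph H G \<and> path_graph k H} = list_graph ` path_lists (adj G) (verts G) k"
proof -
  have lg: "Graph (set vs) {{vs ! i, vs ! Suc i} | i. i < k} = list_graph vs" if "length vs = k + 1" for vs :: "'a list"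
    using that by (simp add: list_graph_def pedges_def)
  have sg: "subgraph (list_graph vs) G \<longleftrightarrow> set vs \<subseteq> verts G \<and> breaks (adj G) vs = 0" for vs
    using assms pedges_subset[of _ vs]
    by (auto simp: subgraph_def list_graph_def simple_graph_def breaks_adj_iff)
  show ?thesis
  proof (intro equalityI subsetI)
    fix H assume "H \<in> {H. subgraph H G \<and> path_graph k H}"
    then obtain vs where "distinct vs" "length vs = k + 1" "H = list_graph vs" "subgraph (list_graph vs) G"
      using lg by (auto simp: path_graph_def)
    then show "H \<in> list_graph ` path_lists (adj G) (verts G) k"
      using sg by (auto simp: path_lists_def)
  next
    fix H assume "H \<in> list_graph ` path_lists (adj G) (verts G) k"
    then obtain vs where vs: "H = list_graph vs" "vs \<in> path_lists (adj G) (verts G) k" by blast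
    then have "path_graph k H"
      using lg[of vs] unfolding path_graph_def path_lists_def by (intro exI[of _ vs]) simp
    then show "H \<in> {H. subgraph H G \<and> path_graph k H}"
      using vs sg[of vs] by (simp add: path_lists_def)
  qed
qed

text \<open>The fibres of \<open>list_graph\<close> are the pairs of a list and its reversal; for
  \<open>k \<ge> 1\<close> the two ends differ, so that each fibre has two elements.\<close>

lemma card_path_lists_eq:
  assumes "simple_graph G" "1 \<le> k"
  shows "card (path_lists (adj G) (verts G) k) = 2 * num_paths k G"
proof -
  let ?P = "path_lists (adj G) (verts G) k"
  define fib where "fib H = {xs \<in> ?P. list_graph xs = H}" for H
  have fin: "finite ?P" using assms(1) by (simp add: simple_graph_def)
  have fib: "fib (list_graph xs) = {xs, rev xs}" if xs: "xs \<in> ?P" for xs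
  proof (intro equalityI subsetI)
    fix ys assume "ys \<in> fib (list_graph xs)"
    then have "ys \<in> ?P" "list_graph ys = list_graph xs" by (auto simp: fib_def)
    then show "ys \<in> {xs, rev xs}"
      using xs pedges_eq_imp[of xs ys] assms(2) by (auto simp: list_graph_def path_lists_def)
  next
    fix ys assume "ys \<in> {xs, rev xs}"
    then show "ys \<in> fib (list_graph xs)"
      using xs breaks_rev[OF symp_adj, of G xs]
      by (auto simp: fib_def path_lists_def list_graph_def pedges_rev)
  qed
  have two: "card {xs, rev xs} = 2" if xs: "xs \<in> ?P" for xs
  proof -
    have "xs \<noteq> rev xs"
    proof
      assume "xs = rev xs"
      then have "hd xs = last xs" by (metis hd_rev)
      then show False using xs assms(2) by (cases xs) (auto simp: path_lists_def split: if_splits)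
    qed
    then show ?thesis by simp
  qed
  have "2 * card (fib ` list_graph ` ?P) = card (\<Union>(fib ` list_graph ` ?P))"
  proof (rule card_partition)
    show "finite (fib ` list_graph ` ?P)" using fin by simp
    show "finite (\<Union>(fib ` list_graph ` ?P))" using fin by (auto simp: fib_def)
    show "card c = 2" if "c \<in> fib ` list_graph ` ?P" for c using that fib two by auto
    show "c1 \<inter> c2 = {}" if "c1 \<in> fib ` list_graph ` ?P" "c2 \<in> fib ` list_graph ` ?P" "c1 \<noteq> c2" for c1 c2
      using that by (auto simp: fib_def)
  qed
  moreover have "\<Union>(fib ` list_graph ` ?P) = ?P" by (auto simp: fib_def)
  moreover have "card (fib ` list_graph ` ?P) = card (list_graph ` ?P)"
  proof (rule card_image, rule inj_onI)
    fix H H' assume *: "H \<in> list_graph ` ?P" "H' \<in> list_graph ` ?P" "fib H = fib H'"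
    then obtain xs where "xs \<in> ?P" "H = list_graph xs" by blast
    then have "xs \<in> fib H" by (simp add: fib_def)
    then have "xs \<in> fib H'" using *(3) by simp
    then show "H = H'" using \<open>H = list_graph xs\<close> by (simp add: fib_def)
  qed
  ultimately show ?thesis by (simp add: num_paths_def path_subgraphs_eq[OF assms(1)])
qed

text \<open>Three vertices are required because two adjacent vertices form a list without cyclic
  breaks but no cycle.\<close>

lemma hamiltonian_iff:
  assumes "simple_graph G" "card (verts G) \<ge> 3"
  shows "hamiltonian G \<longleftrightarrow> \<not> nonham (adj G) (verts G)"
proof -
  let ?C = "\<lambda>vs. {{vs ! i, vs ! (Suc i mod length vs)} | i. i < length vs}"
  have C: "?C vs \<subseteq> edges G \<longleftrightarrow> cyclic_breaks (adj G) vs = 0" if "vs \<noteq> []" for vs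
  proof -
    have "finite (bad_positions (adj G) vs)"
      by (rule finite_subset[of _ "{..<length vs}"]) (auto simp: bad_positions_def)
    then have "cyclic_breaks (adj G) vs = 0 \<longleftrightarrow> bad_positions (adj G) vs = {}"
      using cyclic_breaks_conv_card[OF that] by simp
    then show ?thesis by (auto simp: bad_positions_def adj_def)
  qed
  have sub: "e \<subseteq> set vs" if e: "e \<in> ?C vs" for e and vs :: "'a list"
  proof -
    obtain i where i: "i < length vs" "e = {vs ! i, vs ! (Suc i mod length vs)}" using e by blast
    then have "0 < length vs" by linarith
    then have "Suc i mod length vs < length vs" by (rule mod_less_divisor)
    then show ?thesis using i by simp
  qed
  show ?thesis
  proof
    assume "hamiltonian G"
    then obtain vs where vs: "distinct vs" "length vs \<ge> 3" "subgraph (Graph (set vs) (?C vs)) G" "set vs = verts G"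
      by (auto simp: hamiltonian_def cycle_graph_def)
    have "vs \<noteq> []" using vs(2) by auto
    then have "cyclic_breaks (adj G) vs = 0" using C vs(3) by (simp add: subgraph_def)
    moreover have "vs \<in> permutations_of_set (verts G)" using vs by (simp add: permutations_of_set_def)
    ultimately show "\<not> nonham (adj G) (verts G)" unfolding nonham_def by blast
  next
    assume "\<not> nonham (adj G) (verts G)"
    then obtain vs where vs: "vs \<in> permutations_of_set (verts G)" "cyclic_breaks (adj G) vs = 0"
      unfolding nonham_def by blast
    have p: "distinct vs" "set vs = verts G" "length vs \<ge> 3"
      using vs(1) assms(2) length_permutation[OF vs(1)] by (auto simp: permutations_of_set_def)
    then have "vs \<noteq> []" by auto
    then have e: "?C vs \<subseteq> edges G" using C vs(2) by blast
    have "subgraph (Graph (set vs) (?C vs)) G"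
      unfolding subgraph_def simple_graph_def ugraph.sel
    proof (intro conjI ballI)
      show "e' \<subseteq> set vs" if "e' \<in> ?C vs" for e' using sub[OF that] .
      show "card e' = 2" if "e' \<in> ?C vs" for e' using that e assms(1) by (auto simp: simple_graph_def)
      show "finite (set vs)" by (rule finite_set)
      show "set vs \<subseteq> verts G" using p(2) by simp
      show "?C vs \<subseteq> edges G" by (rule e)
    qed
    moreover have "cycle_graph (Graph (set vs) (?C vs))"
      unfolding cycle_graph_def using p by blast
    moreover have "verts (Graph (set vs) (?C vs)) = verts G" using p(2) by simp
    ultimately show "hamiltonian G" unfolding hamiltonian_def by blast
  qed
qed

section \<open>Recognising \<open>K_dot_K2\<close> up to isomorphism\<close>

lemma pendant_iff:
  assumes "symp E" "\<And>x. \<not> E x x"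
  shows "pendant E V u w \<longleftrightarrow> u \<in> V \<and> w \<in> V \<and> u \<noteq> w \<and>
    (\<forall>x\<in>V. \<forall>y\<in>V. E x y \<longleftrightarrow> x \<noteq> y \<and> (x = w \<longrightarrow> y = u) \<and> (y = w \<longrightarrow> x = u))"
    (is "_ \<longleftrightarrow> ?R")
proof
  assume p: "pendant E V u w"
  then have w: "E w x \<longleftrightarrow> x = u" if "x \<in> V" "x \<noteq> w" for x
    using that by (auto simp: pendant_def nbhd_def)
  have "E x y \<longleftrightarrow> x \<noteq> y \<and> (x = w \<longrightarrow> y = u) \<and> (y = w \<longrightarrow> x = u)" if "x \<in> V" "y \<in> V" for x y
  proof -
    consider "x = y" | "x = w" "y \<noteq> w" | "y = w" "x \<noteq> w" | "x \<noteq> y" "x \<noteq> w" "y \<noteq> w" by blast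
    then show ?thesis
    proof cases
      case 3
      then have "E x y \<longleftrightarrow> E w x" using assms(1) by (auto dest: sympD)
      then show ?thesis using 3 w that by auto
    next
      case 4
      then show ?thesis using p that by (auto simp: pendant_def)
    qed (use assms(2) w that in auto)
  qed
  then show ?R using p by (auto simp: pendant_def)
next
  assume ?R
  then show "pendant E V u w" by (auto simp: pendant_def nbhd_def)
qed

lemma K_dot_K2:
  assumes "n \<ge> 3"
  shows "simple_graph (K_dot_K2 n)" "verts (K_dot_K2 n) = {..<n}"
    "pendant (adj (K_dot_K2 n)) (verts (K_dot_K2 n)) 0 (n - 1)"
proof -
  have V: "verts (K_dot_K2 n) = {..<n}"
    using assms by (auto simp: K_dot_K2_def graph_union_def complete_graph_def)
  have E: "edges (K_dot_K2 n) = {e. e \<subseteq> {0..<n - 1} \<and> card e = 2} \<union> {e. e \<subseteq> {0, n - 1} \<and> card e = 2}"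
    by (simp add: K_dot_K2_def graph_union_def complete_graph_def)
  show "verts (K_dot_K2 n) = {..<n}" by (rule V)
  show S: "simple_graph (K_dot_K2 n)"
    unfolding simple_graph_def V E using assms by auto
  have "adj (K_dot_K2 n) x y \<longleftrightarrow> x \<noteq> y \<and> (x = n - 1 \<longrightarrow> y = 0) \<and> (y = n - 1 \<longrightarrow> x = 0)"
    if "x < n" "y < n" for x y
    using that assms unfolding adj_def E by (auto simp: card_insert_if)
  then show "pendant (adj (K_dot_K2 n)) (verts (K_dot_K2 n)) 0 (n - 1)"
    unfolding pendant_iff[OF symp_adj adj_irrefl[OF S]] V using assms by auto
qed

lemma graph_iso_K_dot_K2_iff:
  assumes "simple_graph G" "card (verts G) = n" "n \<ge> 3"
  shows "graph_iso G (K_dot_K2 n) \<longleftrightarrow> (\<exists>u w. pendant (adj G) (verts G) u w)"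
proof -
  let ?K = "K_dot_K2 n"
  have K: "adj ?K x y \<longleftrightarrow> x \<noteq> y \<and> (x = n - 1 \<longrightarrow> y = 0) \<and> (y = n - 1 \<longrightarrow> x = 0)"
    if "x < n" "y < n" for x y
    using K_dot_K2[OF assms(3)] that unfolding pendant_iff[OF symp_adj adj_irrefl[OF K_dot_K2(1)[OF assms(3)]]]
    by auto
  have V: "verts ?K = {..<n}" using K_dot_K2[OF assms(3)] by simp
  have fin: "finite (verts G)" using assms(1) by (simp add: simple_graph_def)
  note piff = pendant_iff[OF symp_adj adj_irrefl[OF assms(1)]]
  show ?thesis
  proof
    assume "graph_iso G ?K"
    then obtain f where f: "bij_betw f (verts G) {..<n}"
      "\<And>x y. x \<in> verts G \<Longrightarrow> y \<in> verts G \<Longrightarrow> adj G x y \<longleftrightarrow> adj ?K (f x) (f y)"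
      unfolding graph_iso_def V adj_def by blast
    have inj: "f x = f y \<longleftrightarrow> x = y" if "x \<in> verts G" "y \<in> verts G" for x y
      using that f(1) by (auto simp: bij_betw_def inj_on_def)
    have lt: "f x < n" if "x \<in> verts G" for x using that f(1) by (auto simp: bij_betw_def)
    have im: "f ` verts G = {..<n}" using f(1) by (simp add: bij_betw_def)
    obtain u where u: "u \<in> verts G" "f u = 0"
      using im assms(3) by (metis (no_types, lifting) imageE lessThan_iff less_le_trans zero_less_numeral)
    obtain w where w: "w \<in> verts G" "f w = n - 1"
      using im assms(3) by (metis (no_types, lifting) imageE lessThan_iff diff_less less_le_trans zero_less_numeral zero_less_one)
    have "adj G x y \<longleftrightarrow> x \<noteq> y \<and> (x = w \<longrightarrow> y = u) \<and> (y = w \<longrightarrow> x = u)"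
      if "x \<in> verts G" "y \<in> verts G" for x y
      using f(2)[OF that] K[OF lt[OF that(1)] lt[OF that(2)]] inj that u w by metis
    moreover have "u \<noteq> w" using u w assms(3) by auto
    ultimately show "\<exists>u w. pendant (adj G) (verts G) u w" unfolding piff using u w by blast
  next
    assume "\<exists>u w. pendant (adj G) (verts G) u w"
    then obtain u w where p: "u \<in> verts G" "w \<in> verts G" "u \<noteq> w"
      "\<And>x y. x \<in> verts G \<Longrightarrow> y \<in> verts G \<Longrightarrow>
        adj G x y \<longleftrightarrow> x \<noteq> y \<and> (x = w \<longrightarrow> y = u) \<and> (y = w \<longrightarrow> x = u)"
      unfolding piff by blast
    \<comment> \<open>Adjacency depends only on equality and on the positions of \<open>u\<close>
      and \<open>w\<close>, so any bijection between the remaining vertices will do.\<close>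
    have "card (verts G - {u, w}) = card {1..<n - 1}"
      using p(1-3) fin assms(2) by (simp add: card_Diff_subset)
    then obtain g where g: "bij_betw g (verts G - {u, w}) {1..<n - 1}"
      using fin by (metis finite_Diff finite_atLeastLessThan finite_same_card_bij)
    define f where "f x = (if x = u then 0 else if x = w then n - 1 else g x)" for x
    have gr: "g x \<in> {1..<n - 1}" if "x \<in> verts G" "x \<noteq> u" "x \<noteq> w" for x
      using that bij_betwE[OF g] by blast
    have inj: "inj_on f (verts G)"
    proof (rule inj_onI)
      fix x y assume *: "x \<in> verts G" "y \<in> verts G" "f x = f y"
      have gi: "x = y" if "x \<notin> {u, w}" "y \<notin> {u, w}"
        using that * g by (auto simp: f_def bij_betw_def dest: inj_onD)
      show "x = y"
        using * gi gr[of x] gr[of y] assms(3) p(3) by (auto simp: f_def split: if_splits)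
    qed
    have "f ` verts G \<subseteq> {..<n}"
      using gr assms(3) by (fastforce simp: f_def)
    then have "f ` verts G = {..<n}"
      using card_image[OF inj] assms(2) by (intro card_subset_eq) auto
    then have bij: "bij_betw f (verts G) {..<n}" using inj by (simp add: bij_betw_def)
    have fu: "f x = 0 \<longleftrightarrow> x = u" if "x \<in> verts G" for x
      using that gr[of x] assms(3) p(3) by (auto simp: f_def)
    have fw: "f x = n - 1 \<longleftrightarrow> x = w" if "x \<in> verts G" for x
      using that gr[of x] assms(3) p(3) by (auto simp: f_def)
    have lt: "f x < n" if "x \<in> verts G" for x using bij that by (auto simp: bij_betw_def)
    have "adj G x y \<longleftrightarrow> adj ?K (f x) (f y)" if "x \<in> verts G" "y \<in> verts G" for x y
      using p(4)[OF that] K[OF lt[OF that(1)] lt[OF that(2)]] fu fw that inj_on_eq_iff[OF inj that] by metis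
    then show "graph_iso G ?K"
      unfolding graph_iso_def V using bij by (auto simp: adj_def)
  qed
qed

section \<open>Falling factorials and the final count\<close>

lemma falling_mult_fact: "b \<le> a \<Longrightarrow> falling a b * fact (a - b) = fact a"
proof (induction b)
  case (Suc b)
  then have "fact (a - b) = (a - b) * (fact (a - Suc b) :: nat)"
    by (metis Suc_diff_Suc Suc_le_lessD fact_Suc of_nat_id)
  then show ?case using Suc by (simp add: falling_def mult.assoc)
qed (simp add: falling_def)

lemma falling_Suc_Suc: "falling (Suc a) (Suc b) = Suc a * falling a b"
  unfolding falling_def by (simp add: prod.lessThan_Suc_shift del: prod.lessThan_Suc)

text \<open>Doubling removes the division by 2. Multiplying by \<open>fact (n - 1 - k)\<close> turns
  \<open>N\<close> into \<open>(n - 1 - k) * fact (n - 1) + 2 * fact (n - 2)\<close>, the right side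
  of \<open>card_path_lists_le\<close> with the largest possible number of Hamilton lists.\<close>

lemma num_paths_nat:
  fixes n k :: nat
  assumes "n \<ge> 6" "1 \<le> k" "k \<le> n - 1"
  defines "N \<equiv> falling (n - 2) (k - 1) * ((n - 1) * (n - 1 - k) + 2)"
  assumes "simple_graph G" "card (verts G) = n" "nonham (adj G) (verts G)"
  shows "2 * num_paths k G \<le> N" "2 * num_paths k G = N \<longleftrightarrow> graph_iso G (K_dot_K2 n)"
proof -
  let ?h = "card (ham_lists (adj G) (verts G))"
  have fin: "finite (verts G)" using assms(5) by (simp add: simple_graph_def)
  have n6: "card (verts G) \<ge> 6" using assms by simp
  have h: "?h \<le> 2 * fact (n - 2)"
    "?h \<ge> 2 * fact (n - 2) \<Longrightarrow> \<exists>u w. pendant (adj G) (verts G) u w"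
    using card_ham_lists_le[OF symp_adj fin n6 assms(7)] assms(6) by simp_all
  have f1: "fact (n - 1) = (n - 1) * (fact (n - 2) :: nat)"
    using assms(1) fact_reduce[of "n - 1", where 'a = nat] by (simp add: numeral_2_eq_2)
  have "falling (n - 2) (k - 1) * fact (n - 1 - k) = fact (n - 2)"
    using falling_mult_fact[of "k - 1" "n - 2"] assms(1-3) by simp
  moreover have "N * fact (n - 1 - k) =
      ((n - 1) * (n - 1 - k) + 2) * (falling (n - 2) (k - 1) * fact (n - 1 - k))"
    unfolding N_def by (simp only: mult_ac)
  ultimately have Ng: "N * fact (n - 1 - k) = ((n - 1) * (n - 1 - k) + 2) * fact (n - 2)" by simp
  have N: "N * fact (n - 1 - k) = (n - 1 - k) * fact (n - 1) + 2 * fact (n - 2)"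
  proof -
    have "(a * b + 2) * g = b * (a * g) + 2 * g" for a b g :: nat by (simp add: algebra_simps)
    then show ?thesis using Ng unfolding f1 by metis
  qed
  have P: "2 * num_paths k G * fact (n - 1 - k) \<le> (n - 1 - k) * fact (n - 1) + ?h"
  proof -
    have "k < card (verts G)" using assms(1,3,6) by linarith
    note card_path_lists_le[OF fin assms(7,2) this]
    moreover have "n - k - 1 = n - 1 - k" "n - Suc k = n - 1 - k" by simp_all
    ultimately show ?thesis by (simp only: assms(6) card_path_lists_eq[OF assms(5,2)])
  qed
  also have "\<dots> \<le> N * fact (n - 1 - k)" unfolding N using h(1) by (rule add_left_mono)
  finally have "2 * num_paths k G * fact (n - 1 - k) \<le> N * fact (n - 1 - k)" .
  then show "2 * num_paths k G \<le> N" by simp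
  \<comment> \<open>Under equality, cancelling the common term between \<open>P\<close> and
    \<open>N\<close> leaves \<open>?h \<ge> 2 * fact (n - 2)\<close>, the extremal case for Hamilton
    lists.\<close>
  have "\<exists>u w. pendant (adj G) (verts G) u w" if "2 * num_paths k G = N"
    using P N h(2) unfolding that by simp
  moreover have "2 * num_paths k G = N" if p: "pendant (adj G) (verts G) u w" for u w
  proof -
    have "2 * num_paths k G = falling (n - 1) (Suc k) + 2 * falling (n - 2) (k - 1)"
      using card_path_lists_pendant[OF symp_adj fin p assms(2)] card_path_lists_eq[OF assms(5,2)] assms(6) by simp
    also have "falling (n - 1) (Suc k) = (n - 1) * falling (n - 2) k"
    proof -
      have "n - 1 = Suc (n - 2)" using assms(1) by simp
      then show ?thesis using falling_Suc_Suc[of "n - 2" k] by (simp only:)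
    qed
    also have "falling (n - 2) k = falling (n - 2) (k - 1) * (n - 1 - k)"
    proof -
      obtain j where "k = Suc j" using assms(2) by (cases k) auto
      then show ?thesis by (simp add: falling_def)
    qed
    also have "(n - 1) * (falling (n - 2) (k - 1) * (n - 1 - k)) + 2 * falling (n - 2) (k - 1) = N"
    proof -
      have "a * (f * b) + 2 * f = f * (a * b + 2)" for a b f :: nat by (simp add: algebra_simps)
      then show ?thesis unfolding N_def .
    qed
    finally show ?thesis .
  qed
  ultimately show "2 * num_paths k G = N \<longleftrightarrow> graph_iso G (K_dot_K2 n)"
    using graph_iso_K_dot_K2_iff[OF assms(5,6)] assms(1) by auto
qed

theorem theorem2:
  fixes n k :: nat
  assumes "n \<ge> 6" and "1 \<le> k" and "k \<le> n - 1"
  shows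
    "let M = real (falling (n - 2) (k - 1))
               * ((real n - 1) * (real n - 1 - real k) / 2 + 1)
     in K_dot_K2 n \<in> nonhamiltonian_graphs n
      \<and> real (num_paths k (K_dot_K2 n)) = M
      \<and> (\<forall>G \<in> (nonhamiltonian_graphs n :: 'a ugraph set). real (num_paths k G) \<le> M)
      \<and> (\<forall>G \<in> (nonhamiltonian_graphs n :: 'a ugraph set).
            real (num_paths k G) = M \<longleftrightarrow> graph_iso G (K_dot_K2 n))"
proof -
  define N where "N = falling (n - 2) (k - 1) * ((n - 1) * (n - 1 - k) + 2)"
  define M where "M = real (falling (n - 2) (k - 1)) * ((real n - 1) * (real n - 1 - real k) / 2 + 1)"
  have "real (n - 1 - k) = real n - 1 - real k" "real (n - 1) = real n - 1"
    using assms by (simp_all add: of_nat_diff)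
  moreover have "real N = real (falling (n - 2) (k - 1)) * (real (n - 1) * real (n - 1 - k) + 2)"
    unfolding N_def by (simp only: of_nat_mult of_nat_add of_nat_numeral)
  ultimately have NM: "real N = 2 * M" by (simp add: M_def field_simps)
  have n3: "n \<ge> 3" using assms(1) by simp
  have nh: "simple_graph G \<and> card (verts G) = n \<and> nonham (adj G) (verts G)"
    if "G \<in> nonhamiltonian_graphs n" for G :: "'b ugraph"
    using that hamiltonian_iff[of G] n3 by (auto simp: nonhamiltonian_graphs_def order_def)
  \<comment> \<open>The vertex type \<open>'b\<close> is local and generalises, so that these facts
    serve both the graphs over \<open>'a\<close> and \<open>K_dot_K2 n\<close> over
    \<open>nat\<close>.\<close>
  have le: "real (num_paths k G) \<le> M" and eq: "real (num_paths k G) = M \<longleftrightarrow> graph_iso G (K_dot_K2 n)"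
    if "G \<in> nonhamiltonian_graphs n" for G :: "'b ugraph"
  proof -
    have "2 * num_paths k G \<le> N" "2 * num_paths k G = N \<longleftrightarrow> graph_iso G (K_dot_K2 n)"
      using num_paths_nat[OF assms, of G] nh[OF that] by (auto simp: N_def)
    moreover have r: "real (2 * num_paths k G) = 2 * real (num_paths k G)" by simp
    have "2 * num_paths k G \<le> N \<longleftrightarrow> real (2 * num_paths k G) \<le> real N" by (rule of_nat_le_iff[symmetric])
    then have "2 * num_paths k G \<le> N \<longleftrightarrow> real (num_paths k G) \<le> M" unfolding r NM by simp
    moreover have "2 * num_paths k G = N \<longleftrightarrow> real (2 * num_paths k G) = real N" by (rule of_nat_eq_iff[symmetric])
    then have "2 * num_paths k G = N \<longleftrightarrow> real (num_paths k G) = M" unfolding r NM by simp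
    ultimately show "real (num_paths k G) \<le> M" "real (num_paths k G) = M \<longleftrightarrow> graph_iso G (K_dot_K2 n)"
      by blast+
  qed
  have K: "K_dot_K2 n \<in> nonhamiltonian_graphs n"
    using K_dot_K2[OF n3] hamiltonian_iff[of "K_dot_K2 n"] n3
      pendant_nonham[OF symp_adj _ _ K_dot_K2(3)[OF n3]]
    by (auto simp: nonhamiltonian_graphs_def order_def)
  moreover have "real (num_paths k (K_dot_K2 n)) = M"
    using eq[OF K] graph_iso_K_dot_K2_iff[of "K_dot_K2 n" n] K_dot_K2[OF n3] n3 by auto
  ultimately show ?thesis
    using le eq unfolding M_def[symmetric] Let_def by blast
qed

end
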